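(* Let $U\subseteq R_{a,b}$ be a basepoint free four-dimensional subspace, let $S$ be a nonzero syzygy of $I_U$ of bidegree $(0,n)$, suppose $b\geq 2n-1$ and that $I_U$ has no nonzero syzygy of bidegree $(0,m)$ for $m<n$, and let $V\subseteq U$ be the subspace associated to $S$. Assume $\dim V=3$, and let $\mu$ be the integer attached to $S$ defined in the context. Then, besides $S$ in bidegree $(0,n)$, the ideal $I_U$ has syzygies $S_1$ of bidegree $(a,b-n)$, $S_2$ of bidegree $(a,b-n+\mu)$, and $S_3$ of bidegree $(a,b-\mu)$ such that $$\dim_{\mathbb{K}}\langle S,S_1,S_2,S_3\rangle_{2a-1,b-1}=2ab.$$
   Context: $\mathbb{K}$ is an algebraically closed field, $R=\mathbb{K}[s,t,u,v]$ is bigraded by $\deg s=\deg t=(1,0)$, $\deg u=\deg v=(0,1)$, $R_{c,d}$ is its bidegree $(c,d)$ component, and $A=\mathbb{K}[u,v]\subseteq R$. $a,b\ge1$ are integers, $U\subseteq R_{a,b}$ is a four-dimensional $\mathbb{K}$-subspace with basis $\{p_0,p_1,p_2,p_3\}$, and $I_U=(p_0,p_1,p_2,p_3)\subseteq R$. $U$ is basepoint free if $p_0,\dots,p_3$ have no common zero on $\mathbb{P}^1\times\mathbb{P}^1$ (equivalently $\sqrt{I_U}=(s,t)\cap(u,v)$). A syzygy of $I_U$ (with respect to a given list of four generators) is a column in $R^4$ annihilated by the row of generators; it has bidegree $(c,d)$ if all its entries lie in $R_{c,d}$. $\langle T_1,\dots,T_k\rangle$ is the $R$-submodule of $R^4$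 generated by columns $T_i$, and $\langle T_1,\dots,T_k\rangle_{c,d}$ its component consisting of columns with entries in $R_{c,d}$. Write the $i$th entry of $S$ as $\sum_{j=0}^n a_{ij}u^{n-j}v^j$, $a_{ij}\in\mathbb{K}$; put $f_j=\sum_{i=0}^3a_{ij}p_i$ and $V=\mathrm{Span}_{\mathbb{K}}\{f_0,\dots,f_n\}\subseteq U$. The integer $\mu$ (for $\dim V=3$): choose $f_0',f_1',f_2'$ among $f_0,\dots,f_n$ forming a basis of $V$, and let $B$ be the $3\times(n+1)$ matrix over $\mathbb{K}$ with $[f_0'\ f_1'\ f_2']B=[f_0\ \cdots\ f_n]$. Set $[g_0\ g_1\ g_2]^T=B[u^n\ u^{n-1}v\ \cdots\ v^n]^T$ (so, after completing to a generating set $f_0',f_1',f_2',p_3$ of $I_U$, $S$ becomes $[g_0\ g_1\ g_2\ 0]^T$). The ideal $(g_0,g_1,g_2)$ of $A$ has height two and a minimal graded free resolution $0\to A(-n-\mu)\oplus A(-2n+\mu)\to A^3(-n)\to A$ with $1\le\mu\le n-\mu$; this defines $\mu$. *)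

theory Defs
  imports
    "HOL-Analysis.Finite_Cartesian_Product"
    "HOL-Computational_Algebra.Polynomial"
    "HOL-Library.Poly_Mapping"
    "HOL-Library.Numeral_Type"
begin

text \<open>
  The ring \<open>R = K[s,t,u,v]\<close> is the monoid algebra of the monomials in four variables: a polynomial
  is a finitely supported map from monomials (finitely supported exponent maps) to coefficients.
\<close>

datatype var = Vs | Vt | Vu | Vv

lemma UNIV_var: "(UNIV :: var set) = {Vs, Vt, Vu, Vv}"
  using var.exhaust by auto

instance var :: finite
  by standard (simp add: UNIV_var)

text \<open>An order on the variables is only there to obtain the library's integral domain instance
  for \<open>R\<close>.\<close>

fun var_index :: "var \<Rightarrow> nat" where
  "var_index Vs = 0"
| "var_index Vt = 1"
| "var_index Vu = 2"
| "var_index Vv = 3"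

lemma var_index_inj: "var_index x = var_index y \<Longrightarrow> x = y"
  by (cases x; cases y) auto

instantiation var :: linorder
begin

definition less_eq_var :: "var \<Rightarrow> var \<Rightarrow> bool" where
  "x \<le> y \<longleftrightarrow> var_index x \<le> var_index y"

definition less_var :: "var \<Rightarrow> var \<Rightarrow> bool" where
  "x < y \<longleftrightarrow> var_index x < var_index y"

instance
  by standard (auto simp: less_eq_var_def less_var_def intro: var_index_inj)

end

type_synonym mon = "var \<Rightarrow>\<^sub>0 nat"
type_synonym 'k R = "mon \<Rightarrow>\<^sub>0 'k"

definition const :: "'k::zero \<Rightarrow> 'k R" where
  "const c = Poly_Mapping.single 0 c"

definition eval :: "(var \<Rightarrow> 'k::comm_ring_1) \<Rightarrow> 'k R \<Rightarrow> 'k" where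
  "eval x f = (\<Sum>m\<in>Poly_Mapping.keys f.
     Poly_Mapping.lookup f m * (\<Prod>i\<in>UNIV. x i ^ Poly_Mapping.lookup m i))"

definition bihom :: "nat \<Rightarrow> nat \<Rightarrow> 'k::zero R set" where
  "bihom c d = {f. \<forall>m\<in>Poly_Mapping.keys f.
     Poly_Mapping.lookup m Vs + Poly_Mapping.lookup m Vt = c \<and>
     Poly_Mapping.lookup m Vu + Poly_Mapping.lookup m Vv = d}"

text \<open>The subring \<open>A = K[u,v]\<close>. Its component of degree \<open>d\<close> is \<open>bihom 0 d\<close>.\<close>

definition A_ring :: "'k::zero R set" where
  "A_ring = {f. \<forall>m\<in>Poly_Mapping.keys f.
     Poly_Mapping.lookup m Vs = 0 \<and> Poly_Mapping.lookup m Vt = 0}"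

definition uv_mon :: "nat \<Rightarrow> nat \<Rightarrow> mon" where
  "uv_mon k l = Poly_Mapping.single Vu k + Poly_Mapping.single Vv l"


text \<open>\<open>R\<close> and \<open>R\<^sup>4\<close> as \<open>K\<close>-vector spaces, and \<open>R\<^sup>4\<close> as an \<open>R\<close>-module.\<close>

definition kscale :: "'k::field \<Rightarrow> 'k R \<Rightarrow> 'k R" where
  "kscale c f = const c * f"

definition kscale4 :: "'k::field \<Rightarrow> 'k R ^ 4 \<Rightarrow> 'k R ^ 4" where
  "kscale4 c T = const c *s T"

lemma const_add: "const (c + d :: 'k::field) = const c + const d"
  by (simp add: const_def Poly_Mapping.single_add)

lemma const_mult: "const (c * d :: 'k::field) = const c * const d"
  by (simp add: const_def Poly_Mapping.mult_single)

lemma const_one: "const (1 :: 'k::field) = 1"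
  by (simp add: const_def)

interpretation KR: vector_space "kscale :: 'k::field \<Rightarrow> 'k R \<Rightarrow> 'k R"
  by standard (simp_all add: kscale_def const_add const_mult const_one algebra_simps)

interpretation KR4: vector_space "kscale4 :: 'k::field \<Rightarrow> 'k R ^ 4 \<Rightarrow> 'k R ^ 4"
  by standard
    (simp_all add: kscale4_def const_add const_mult const_one vec_eq_iff algebra_simps)

interpretation RR4: module "(*s) :: 'k::field R \<Rightarrow> 'k R ^ 4 \<Rightarrow> 'k R ^ 4"
  by standard (simp_all add: vec_eq_iff algebra_simps)

definition bihom4 :: "nat \<Rightarrow> nat \<Rightarrow> ('k::zero R ^ 4) set" where
  "bihom4 c d = {T. \<forall>i. T $ i \<in> bihom c d}"

definition is_basis_of :: "('i \<Rightarrow> 'k::field R) \<Rightarrow> 'k R set \<Rightarrow> bool" where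
  "is_basis_of q W \<longleftrightarrow> inj q \<and> \<not> KR.dependent (q ` UNIV) \<and> KR.span (q ` UNIV) = W"

text \<open>A point of \<open>P\<^sup>1 \<times> P\<^sup>1\<close> is represented by a pair of nonzero homogeneous coordinate vectors.\<close>

definition basepoint_free :: "'k::field R ^ 4 \<Rightarrow> bool" where
  "basepoint_free p \<longleftrightarrow>
     (\<forall>x :: var \<Rightarrow> 'k. (x Vs \<noteq> 0 \<or> x Vt \<noteq> 0) \<and> (x Vu \<noteq> 0 \<or> x Vv \<noteq> 0) \<longrightarrow>
        (\<exists>i. eval x (p $ i) \<noteq> 0))"

definition syzygies :: "'k::field R ^ 4 \<Rightarrow> ('k R ^ 4) set" where
  "syzygies p = {T. (\<Sum>i\<in>UNIV. T $ i * p $ i) = 0}"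

definition assoc_f :: "'k::field R ^ 4 \<Rightarrow> 'k R ^ 4 \<Rightarrow> nat \<Rightarrow> nat \<Rightarrow> 'k R" where
  "assoc_f p S n j =
     (\<Sum>i\<in>UNIV. kscale (Poly_Mapping.lookup (S $ i) (uv_mon (n - j) j)) (p $ i))"

definition assoc_V :: "'k::field R ^ 4 \<Rightarrow> 'k R ^ 4 \<Rightarrow> nat \<Rightarrow> 'k R set" where
  "assoc_V p S n = KR.span (assoc_f p S n ` {0..n})"

text \<open>
  \<open>0 \<rightarrow> A(-n-\<mu>) \<oplus> A(-2n+\<mu>) \<rightarrow> A\<^sup>3(-n) \<rightarrow> A\<close> is exact, where the second map is the row \<open>g\<close> and the
  first one sends the two free generators to columns \<open>P\<close>, \<open>Q\<close>; for the map to be graded, the entries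
  of \<open>P\<close> have degree \<open>(n+\<mu>) - n = \<mu>\<close> and those of \<open>Q\<close> have degree \<open>(2n-\<mu>) - n = n - \<mu>\<close>.
  The bounds \<open>1 \<le> \<mu> \<le> n - \<mu>\<close> make all entries of both maps lie in the maximal ideal \<open>(u,v)\<close>,
  that is, the resolution is minimal.
\<close>

definition has_resolution :: "'k::field R ^ 3 \<Rightarrow> nat \<Rightarrow> nat \<Rightarrow> bool" where
  "has_resolution g n \<mu> \<longleftrightarrow>
     1 \<le> \<mu> \<and> \<mu> \<le> n - \<mu> \<and> (\<forall>k. g $ k \<in> bihom 0 n) \<and>
     (\<exists>P Q :: 'k R ^ 3.
        (\<forall>k. P $ k \<in> bihom 0 \<mu>) \<and> (\<forall>k. Q $ k \<in> bihom 0 (n - \<mu>)) \<and>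
        (\<forall>x\<in>A_ring. \<forall>y\<in>A_ring. x *s P + y *s Q = 0 \<longrightarrow> x = 0 \<and> y = 0) \<and>
        {w. (\<forall>k. w $ k \<in> A_ring) \<and> (\<Sum>k\<in>UNIV. w $ k * g $ k) = 0} =
          {x *s P + y *s Q | x y. x \<in> A_ring \<and> y \<in> A_ring})"

text \<open>
  \<open>\<mu>\<close> is the integer attached to the syzygy \<open>S\<close> of bidegree \<open>(0,n)\<close>. The basis
  \<open>f'\<close> of \<open>V\<close> is \<open>f' k = f (J k)\<close>; columns of the matrix \<open>B\<close> are indexed by \<open>0..n\<close>.
\<close>

definition is_mu :: "'k::field R ^ 4 \<Rightarrow> 'k R ^ 4 \<Rightarrow> nat \<Rightarrow> nat \<Rightarrow> bool" where
  "is_mu p S n \<mu> \<longleftrightarrow>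
     (\<exists>(J :: 3 \<Rightarrow> nat) (B :: 3 \<Rightarrow> nat \<Rightarrow> 'k).
        (\<forall>k. J k \<le> n) \<and>
        is_basis_of (\<lambda>k. assoc_f p S n (J k)) (assoc_V p S n) \<and>
        (\<forall>j\<le>n. (\<Sum>k\<in>UNIV. kscale (B k j) (assoc_f p S n (J k))) = assoc_f p S n j) \<and>
        has_resolution
          (\<chi> k. \<Sum>j = 0..n. Poly_Mapping.single (uv_mon (n - j) j) (B k j)) n \<mu>)"

end

theory Submission
  imports Defs "HOL-Analysis.Cartesian_Space"
begin

text \<open>
  Choose a basis \<open>F = (f\<^sub>0', f\<^sub>1', f\<^sub>2')\<close> of \<open>V\<close> and complete it by some \<open>q = p\<^sub>i\<close> to a basis of \<open>U\<close>
  (\<open>complete_to_basis\<close>). In these generators \<open>S\<close> is the column \<open>(g\<^sub>0, g\<^sub>1, g\<^sub>2, 0)\<close> with entries in \<open>A\<close>. The relation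
  \<open>g \<cdot> F = 0\<close> can be read the other way round: \<open>F\<close> is a syzygy of \<open>g\<close>. As \<open>R\<close> is free over \<open>A\<close>, the
  resolution of \<open>(g\<^sub>0, g\<^sub>1, g\<^sub>2)\<close> gives \<open>F = x P + y Q\<close>, where \<open>P\<close> and \<open>Q\<close> have degrees \<open>\<mu>\<close> and \<open>\<nu> = n - \<mu>\<close>, so \<open>x\<close>
  has bidegree \<open>(a, b - \<mu>)\<close> and \<open>y\<close> has bidegree \<open>(a, b - \<nu>)\<close> (\<open>syzygies_over_A_extend\<close>).

  A column \<open>(w, h)\<close> is then a syzygy if and only if \<open>x (w \<cdot> P) + y (w \<cdot> Q) + h q = 0\<close>. So every Koszul relation
  of \<open>x, y, q\<close> that can be lifted along the pairing \<open>w \<mapsto> (w \<cdot> P, w \<cdot> Q)\<close> yields a syzygy. In degree \<open>n - 1\<close> in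
  \<open>u,v\<close> the pairing is injective on triples over \<open>A\<close>, because \<open>S\<close> has least degree, hence bijective by a dimension
  count, and it stays surjective in all higher degrees (\<open>pairing_surjective\<close>). The assumption \<open>b \<ge> 2n - 1\<close> says
  that \<open>b - n \<ge> n - 1\<close>, and so all three Koszul relations lift; the lifts are \<open>S\<^sub>1\<close>, \<open>S\<^sub>2\<close>, \<open>S\<^sub>3\<close>.

  For the dimension it suffices that \<open>\<alpha> S + \<beta>\<^sub>1 S\<^sub>1 + \<beta>\<^sub>2 S\<^sub>2 + \<beta>\<^sub>3 S\<^sub>3 = 0\<close> with coefficients of the bidegrees complementary to
  \<open>(2a - 1, b - 1)\<close> forces all of them to vanish (\<open>dim_graded_piece_of_span\<close>), since
  \<open>2a (b - n) + a n + a (n - \<mu>) + a \<mu> = 2ab\<close>. Pairing with \<open>P\<close> and \<open>Q\<close> removes \<open>S\<close> and leaves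
  \<open>\<beta>\<^sub>1 x = q \<beta>\<^sub>2\<close> and \<open>\<beta>\<^sub>1 y = - q \<beta>\<^sub>3\<close>, where the \<open>\<beta>\<^sub>i\<close> have degree \<open>a - 1\<close> in \<open>s,t\<close> while \<open>q\<close> has degree \<open>a\<close>. A common zero of
  \<open>x, y, q\<close> would be a basepoint of \<open>U\<close>, and without common zeros such a relation is trivial
  (\<open>low_degree_relation_zero\<close>): on a line with \<open>(u:v)\<close> fixed, \<open>\<beta>\<^sub>1\<close> has too few zeros to contain those of \<open>q\<close>.
\<close>

section \<open>Bihomogeneous components\<close>

abbreviation lookup :: "('a \<Rightarrow>\<^sub>0 'b::zero) \<Rightarrow> 'a \<Rightarrow> 'b" where
  "lookup \<equiv> Poly_Mapping.lookup"

abbreviation keys :: "('a \<Rightarrow>\<^sub>0 'b::zero) \<Rightarrow> 'a set" where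
  "keys \<equiv> Poly_Mapping.keys"

abbreviation single :: "'a \<Rightarrow> 'b \<Rightarrow> 'a \<Rightarrow>\<^sub>0 'b::zero" where
  "single \<equiv> Poly_Mapping.single"

definition mons :: "nat \<Rightarrow> nat \<Rightarrow> mon set" where
  "mons c d = {m. lookup m Vs + lookup m Vt = c \<and> lookup m Vu + lookup m Vv = d}"

lemma bihom_iff: "f \<in> bihom c d \<longleftrightarrow> keys f \<subseteq> mons c d"
  by (auto simp: bihom_def mons_def)

lemma mons_add: "m \<in> mons c d \<Longrightarrow> m' \<in> mons c' d' \<Longrightarrow> m + m' \<in> mons (c + c') (d + d')"
  by (auto simp: mons_def lookup_add)

lemma mon_eqI:
  assumes "lookup m Vs = lookup m' Vs" "lookup m Vt = lookup m' Vt"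
    "lookup m Vu = lookup m' Vu" "lookup m Vv = lookup (m' :: mon) Vv"
  shows "m = m'"
  by (rule poly_mapping_eqI, rename_tac i, case_tac i) (use assms in auto)

definition mon_of :: "nat \<Rightarrow> nat \<Rightarrow> nat \<Rightarrow> nat \<Rightarrow> mon" where
  "mon_of i j k l = single Vs i + single Vt j + single Vu k + single Vv l"

lemma lookup_mon_of [simp]:
  "lookup (mon_of i j k l) Vs = i" "lookup (mon_of i j k l) Vt = j"
  "lookup (mon_of i j k l) Vu = k" "lookup (mon_of i j k l) Vv = l"
  by (simp_all add: mon_of_def lookup_add lookup_single)

lemma bij_betw_mons:
  "bij_betw (\<lambda>(j, l). mon_of (c - j) j (d - l) l) ({..c} \<times> {..d}) (mons c d)"
proof (rule bij_betw_byWitness[where f' = "\<lambda>m. (lookup m Vt, lookup m Vv)"])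
  show "\<forall>m\<in>mons c d. (case (lookup m Vt, lookup m Vv) of
      (j, l) \<Rightarrow> mon_of (c - j) j (d - l) l) = m"
    by (auto simp: mons_def intro!: mon_eqI)
qed (auto simp: mons_def)

lemma finite_mons [simp]: "finite (mons c d)"
  using bij_betw_finite[OF bij_betw_mons[of c d]] by simp

lemma card_mons [simp]: "card (mons c d) = Suc c * Suc d"
  using bij_betw_same_card[OF bij_betw_mons[of c d]] by simp

lemma poly_mapping_sum_singles: "f = (\<Sum>m\<in>keys f. single m (lookup f m))"
proof (rule poly_mapping_eqI)
  fix m
  have "lookup (\<Sum>m\<in>keys f. single m (lookup f m)) m
      = (\<Sum>m'\<in>keys f. if m' = m then lookup f m' else 0)"
    by (auto simp: lookup_sum lookup_single when_def intro!: sum.cong)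
  then show "lookup f m = lookup (\<Sum>m\<in>keys f. single m (lookup f m)) m"
    by (simp add: in_keys_iff)
qed

lemma poly_mapping_induct_within [consumes 1, case_names zero add single]:
  assumes "keys f \<subseteq> N" and "P 0"
    and "\<And>f g. P f \<Longrightarrow> P g \<Longrightarrow> P (f + g)"
    and "\<And>m k. m \<in> N \<Longrightarrow> P (single m k)"
  shows "P (f :: 'a \<Rightarrow>\<^sub>0 'b::comm_monoid_add)"
proof -
  have "finite X \<Longrightarrow> X \<subseteq> N \<Longrightarrow> P (\<Sum>m\<in>X. single m (lookup f m))" for X
    by (induction X rule: finite_induct) (use assms in auto)
  from this[of "keys f"] assms(1) show ?thesis
    by (simp flip: poly_mapping_sum_singles)
qed

lemma single_in_bihom: "m \<in> mons c d \<Longrightarrow> single m k \<in> bihom c d"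
  by (auto simp: bihom_iff split: if_splits)

lemma bihom_zero [simp]: "0 \<in> bihom c d"
  by (simp add: bihom_iff)

lemma bihom_add: "f \<in> bihom c d \<Longrightarrow> g \<in> bihom c d \<Longrightarrow> f + g \<in> bihom c d"
  using keys_add[of f g] by (auto simp: bihom_iff)

lemma bihom_uminus: "(f :: 'k::comm_ring_1 R) \<in> bihom c d \<Longrightarrow> - f \<in> bihom c d"
  by (simp add: bihom_iff)

lemma bihom_sum: "(\<And>i. i \<in> I \<Longrightarrow> f i \<in> bihom c d) \<Longrightarrow> sum f I \<in> bihom c d"
  by (induction I rule: infinite_finite_induct) (auto intro: bihom_add)

lemma bihom_mult:
  assumes "f \<in> bihom c d" "g \<in> bihom c' d'"
  shows "f * g \<in> bihom (c + c') (d + d')"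
proof -
  have "keys (f * g) \<subseteq> {m + m' | m m'. m \<in> keys f \<and> m' \<in> keys g}"
    by (rule keys_mult)
  with assms show ?thesis unfolding bihom_iff by (blast intro: mons_add)
qed

lemma bihom_const [simp]: "const k \<in> bihom 0 0"
  by (auto simp: bihom_iff const_def mons_def split: if_splits)

lemma bihom_const_mult: "f \<in> bihom c d \<Longrightarrow> const k * f \<in> bihom c d"
  using bihom_mult[OF bihom_const, of f c d k] by simp

lemma one_in_A_ring: "(1 :: 'k::comm_ring_1 R) \<in> A_ring"
  by (auto simp: A_ring_def simp flip: single_one split: if_splits)

lemma bihom_0_subset_A_ring: "bihom 0 d \<subseteq> A_ring"
  by (auto simp: bihom_def A_ring_def)

definition bicomp :: "nat \<Rightarrow> nat \<Rightarrow> 'k::zero R \<Rightarrow> 'k R" where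
  "bicomp c d f = Poly_Mapping.mapp (\<lambda>m k. k when m \<in> mons c d) f"

lemma lookup_bicomp: "lookup (bicomp c d f) m = (lookup f m when m \<in> mons c d)"
  by (auto simp: bicomp_def lookup_mapp when_def in_keys_iff)

lemma bicomp_in_bihom: "bicomp c d f \<in> bihom c d"
  by (auto simp: bihom_iff in_keys_iff lookup_bicomp)

lemma bicomp_add: "bicomp c d (f + g) = bicomp c d f + bicomp c d g"
  by (rule poly_mapping_eqI) (simp add: lookup_bicomp lookup_add when_def)

lemma bicomp_zero [simp]: "bicomp c d 0 = 0"
  by (rule poly_mapping_eqI) (simp add: lookup_bicomp)

lemma bicomp_sum: "bicomp c d (sum f I) = (\<Sum>i\<in>I. bicomp c d (f i))"
  by (induction I rule: infinite_finite_induct)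
    (simp_all add: bicomp_add)

lemma bicomp_bihom:
  assumes "f \<in> bihom c d"
  shows "bicomp c' d' f = (if c' = c \<and> d' = d then f else 0)"
proof (rule poly_mapping_eqI)
  fix m
  show "lookup (bicomp c' d' f) m = lookup (if c' = c \<and> d' = d then f else 0) m"
  proof (cases "m \<in> keys f")
    case True
    then have "m \<in> mons c d" using assms by (auto simp: bihom_iff)
    then have "m \<in> mons c' d' \<longleftrightarrow> c' = c \<and> d' = d" by (auto simp: mons_def)
    then show ?thesis by (simp add: lookup_bicomp)
  next
    case False
    then show ?thesis by (simp add: lookup_bicomp in_keys_iff)
  qed
qed

text \<open>The grading is multiplicative, so taking components commutes with multiplication by a
  bihomogeneous polynomial, up to a shift.\<close>

lemma bicomp_mult_bihom:
  fixes f g :: "'k::comm_ring_1 R"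
  assumes g: "g \<in> bihom c' d'"
  shows "bicomp (c + c') (d + d') (f * g) = bicomp c d f * g"
proof -
  have "keys f \<subseteq> UNIV" by simp
  then show ?thesis
  proof (induction f rule: poly_mapping_induct_within)
    case zero
    show ?case by simp
  next
    case (add f h)
    then show ?case by (simp add: distrib_right bicomp_add)
  next
    case (single m k)
    define e e' where "e = lookup m Vs + lookup m Vt" and "e' = lookup m Vu + lookup m Vv"
    have s: "single m k \<in> bihom e e'"
      by (rule single_in_bihom) (simp add: mons_def e_def e'_def)
    show ?case
      using bicomp_bihom[OF s, of c d] bicomp_bihom[OF bihom_mult[OF s g], of "c + c'" "d + d'"]
      by simp
  qed
qed

section \<open>Splitting off a variable\<close>

definition X :: "var \<Rightarrow> 'k::comm_ring_1 R" where
  "X i = single (single i 1) 1"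

lemma single_split_var:
  assumes "lookup m i > 0"
  shows "single m k = X i * single (m - single i 1) k"
proof -
  have "single i 1 + (m - single i 1) = m"
    using assms by (intro poly_mapping_eqI) (auto simp: lookup_add lookup_minus lookup_single when_def)
  then show ?thesis by (simp add: X_def mult_single)
qed

lemma X_ne_0 [simp]: "(X i :: 'k::comm_ring_1 R) \<noteq> 0"
proof
  assume "X i = (0 :: 'k R)"
  then have "keys (X i :: 'k R) = {}" by simp
  then show False by (simp add: X_def)
qed

lemma X_st_in_bihom: "i \<in> {Vs, Vt} \<Longrightarrow> X i \<in> bihom 1 0"
  by (auto simp: X_def intro!: single_in_bihom simp: mons_def lookup_single)

lemma X_uv_in_bihom: "i \<in> {Vu, Vv} \<Longrightarrow> X i \<in> bihom 0 1"
  by (auto simp: X_def intro!: single_in_bihom simp: mons_def lookup_single)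

text \<open>Sort the monomials according to which of the two variables is split off. Lowering the degree
  in \<open>s,t\<close> or in \<open>u,v\<close> in this way is what makes induction on a bidegree possible.\<close>

lemma split_two_vars:
  fixes f :: "'k::comm_ring_1 R"
  assumes "keys f \<subseteq> N'"
    and N: "\<And>m. m \<in> N' \<Longrightarrow> lookup m i > 0 \<and> m - single i 1 \<in> N \<or> lookup m j > 0 \<and> m - single j 1 \<in> N"
  shows "\<exists>f' f''. keys f' \<subseteq> N \<and> keys f'' \<subseteq> N \<and> f = X i * f' + X j * f''"
  using assms(1)
proof (induction f rule: poly_mapping_induct_within)
  case zero
  show ?case by (intro exI[of _ 0]) auto
next
  case (add f g)
  then obtain f' f'' g' g'' where "keys f' \<subseteq> N" "keys f'' \<subseteq> N" "keys g' \<subseteq> N" "keys g'' \<subseteq> N"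
    and "f = X i * f' + X j * f''" "g = X i * g' + X j * g''" by blast
  moreover from this have "keys (f' + g') \<subseteq> N" "keys (f'' + g'') \<subseteq> N"
    using keys_add[of f' g'] keys_add[of f'' g''] by auto
  ultimately show ?case
    by - (rule exI[of _ "f' + g'"], rule exI[of _ "f'' + g''"], simp add: algebra_simps)
next
  case (single m k)
  have split: "single m k = X l * single (m - single l 1) k + X l' * 0" if "lookup m l > 0" for l l'
    using single_split_var[OF that] by simp
  have keys: "keys (single (m - single l 1) k) \<subseteq> N" if "m - single l 1 \<in> N" for l
    using that by (auto split: if_splits)
  from N[OF single] show ?case
  proof (elim disjE conjE)
    assume "lookup m i > 0" "m - single i 1 \<in> N"
    then show ?thesis using split[of i j] keys[of i]
      by - (rule exI[of _ "single (m - single i 1) k"], rule exI[of _ 0], auto)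
  next
    assume "lookup m j > 0" "m - single j 1 \<in> N"
    then show ?thesis using split[of j i] keys[of j]
      by - (rule exI[of _ 0], rule exI[of _ "single (m - single j 1) k"], auto)
  qed
qed

lemma bihom_split_st:
  assumes "f \<in> bihom (Suc c) d"
  shows "\<exists>f'\<in>bihom c d. \<exists>f''\<in>bihom c d. f = X Vs * f' + X Vt * (f'' :: 'k::comm_ring_1 R)"
proof -
  have "keys f \<subseteq> mons (Suc c) d" using assms by (simp add: bihom_iff)
  then have "\<exists>f' f''. keys f' \<subseteq> mons c d \<and> keys f'' \<subseteq> mons c d \<and> f = X Vs * f' + X Vt * f''"
    by (rule split_two_vars) (auto simp: mons_def lookup_minus lookup_single)
  then show ?thesis unfolding Bex_def bihom_iff by blast
qed

lemma bihom_split_uv: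
  assumes "f \<in> bihom c (Suc d)"
  shows "\<exists>f'\<in>bihom c d. \<exists>f''\<in>bihom c d. f = X Vu * f' + X Vv * (f'' :: 'k::comm_ring_1 R)"
proof -
  have "keys f \<subseteq> mons c (Suc d)" using assms by (simp add: bihom_iff)
  then have "\<exists>f' f''. keys f' \<subseteq> mons c d \<and> keys f'' \<subseteq> mons c d \<and> f = X Vu * f' + X Vv * f''"
    by (rule split_two_vars) (auto simp: mons_def lookup_minus lookup_single)
  then show ?thesis unfolding Bex_def bihom_iff by blast
qed

text \<open>Only the monomials free of \<open>s\<close> survive modulo \<open>s\<close>, and their power of \<open>t\<close> is determined by the
  bidegree. Iterating the step expands a form along the \<open>A\<close>-basis \<open>s\<^sup>i t\<^sup>c\<^sup>-\<^sup>i\<close>.\<close>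

lemma bihom_mod_s:
  assumes "f \<in> bihom (Suc c) d"
  shows "\<exists>f'\<in>bihom c d. \<exists>h\<in>bihom 0 d. f = X Vs * f' + X Vt ^ Suc c * (h :: 'k::comm_ring_1 R)"
  using assms
proof (induction c arbitrary: f)
  case 0
  then show ?case using bihom_split_st[of f 0 d] by simp
next
  case (Suc c)
  obtain f' f'' where f: "f' \<in> bihom (Suc c) d" "f'' \<in> bihom (Suc c) d" "f = X Vs * f' + X Vt * f''"
    using bihom_split_st[OF Suc.prems] by blast
  obtain k h where k: "k \<in> bihom c d" "h \<in> bihom 0 d" "f'' = X Vs * k + X Vt ^ Suc c * h"
    using Suc.IH[OF f(2)] by blast
  have "X Vt * k \<in> bihom (Suc c) d"
    using bihom_mult[OF X_st_in_bihom k(1), of Vt] by simp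
  then show ?case using f k
    by (intro bexI[of _ "f' + X Vt * k"] bexI[of _ h]) (auto simp: algebra_simps intro: bihom_add)
qed

text \<open>The monomials of the first summand are divisible by \<open>s\<close> and those of the second are not, so
  nothing can cancel.\<close>

lemma s_t_independent:
  fixes f h :: "'k::idom R"
  assumes "X Vs * f + X Vt ^ c * h = 0" "h \<in> bihom 0 d"
  shows "f = 0 \<and> h = 0"
proof -
  have Xt: "(X Vt ^ c :: 'k R) = single (single Vt c) 1"
    by (induction c) (simp_all add: X_def mult_single flip: single_add)
  have eq: "X Vt ^ c * h = - (X Vs * f)" using assms(1) by (simp add: eq_neg_iff_add_eq_0 add.commute)
  have "m \<notin> keys (X Vt ^ c * h)" for m
  proof
    assume m: "m \<in> keys (X Vt ^ c * h)"
    then have "m \<in> keys (X Vs * f)" by (simp add: eq)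
    then have "lookup m Vs > 0"
      using keys_mult[of "X Vs" f] by (auto simp: X_def lookup_add lookup_single)
    moreover have "lookup m Vs = 0"
      using m keys_mult[of "X Vt ^ c" h] assms(2)
      by (auto simp: Xt lookup_add lookup_single bihom_def)
    ultimately show False by simp
  qed
  then have "X Vt ^ c * h = 0" by (metis keys_eq_empty equals0I)
  then show ?thesis using assms(1) by simp
qed

section \<open>Substitution and specialization to a line\<close>

definition subst :: "(var \<Rightarrow> 'k::comm_ring_1 poly) \<Rightarrow> 'k R \<Rightarrow> 'k poly" where
  "subst x f = (\<Sum>m\<in>keys f. smult (lookup f m) (\<Prod>i\<in>UNIV. x i ^ lookup m i))"

lemma subst_superset:
  assumes "finite N" "keys f \<subseteq> N"
  shows "subst x f = (\<Sum>m\<in>N. smult (lookup f m) (\<Prod>i\<in>UNIV. x i ^ lookup m i))"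
  unfolding subst_def by (rule sum.mono_neutral_left) (use assms in \<open>auto simp: in_keys_iff\<close>)

lemma subst_zero [simp]: "subst x 0 = 0"
  by (simp add: subst_def)

lemma subst_add: "subst x (f + g) = subst x f + subst x g"
proof -
  let ?N = "keys f \<union> keys g"
  have "subst x h = (\<Sum>m\<in>?N. smult (lookup h m) (\<Prod>i\<in>UNIV. x i ^ lookup m i))"
    if "h \<in> {f, g, f + g}" for h
    using that keys_add[of f g] by (intro subst_superset) auto
  then show ?thesis by (simp add: lookup_add smult_add_left sum.distrib)
qed

lemma subst_single: "subst x (single m k) = smult k (\<Prod>i\<in>UNIV. x i ^ lookup m i)"
  by (subst subst_superset[of "{m}"]) (auto split: if_splits)

lemma subst_mult: "subst x (f * g) = subst x f * subst x g"
proof -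
  have *: "subst x (single m k * g) = subst x (single m k) * subst x g" for m k
  proof -
    have "keys g \<subseteq> UNIV" by simp
    then show ?thesis
      by (induction g rule: poly_mapping_induct_within)
        (simp_all add: distrib_left subst_add mult_single subst_single lookup_add power_add
          prod.distrib mult.left_commute, simp add: mult.commute)
  qed
  have "keys f \<subseteq> UNIV" by simp
  then show ?thesis
    by (induction f rule: poly_mapping_induct_within) (simp_all add: distrib_right subst_add *)
qed

lemma poly_subst: "poly (subst x f) z = eval (\<lambda>i. poly (x i) z) f"
  by (simp add: subst_def eval_def poly_sum poly_prod)

lemma eval_eq_poly_subst: "eval x f = poly (subst (\<lambda>i. [:x i:]) f) 0"
  by (simp add: poly_subst)

lemma eval_zero [simp]: "eval x 0 = 0"
  and eval_add: "eval x (f + g) = eval x f + eval x g"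
  and eval_mult: "eval x (f * g) = eval x f * eval x g"
  by (simp_all add: eval_eq_poly_subst subst_add subst_mult)

lemma eval_sum: "eval x (sum f I) = (\<Sum>i\<in>I. eval x (f i))"
  by (induction I rule: infinite_finite_induct) (simp_all add: eval_add)

text \<open>The affine line \<open>s = u = 1\<close>, \<open>v = v\<^sub>0\<close> with coordinate \<open>t\<close>. Its projective closure in
  \<open>P\<^sup>1 \<times> P\<^sup>1\<close> has one more point, \<open>((0:1), (1:v\<^sub>0))\<close>, where a form of bidegree \<open>(a,b)\<close> takes
  the value of the coefficient of \<open>t\<^sup>a\<close>.\<close>

definition line :: "'k::comm_ring_1 \<Rightarrow> 'k R \<Rightarrow> 'k poly" where
  "line v0 = subst (\<lambda>i. case i of Vs \<Rightarrow> 1 | Vt \<Rightarrow> [:0, 1:] | Vu \<Rightarrow> 1 | Vv \<Rightarrow> [:v0:])"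

lemma line_mult: "line v0 (f * g) = line v0 f * line v0 g"
  by (simp add: line_def subst_mult)

lemma poly_line:
  "poly (line v0 f) q = eval (\<lambda>i. case i of Vs \<Rightarrow> 1 | Vt \<Rightarrow> q | Vu \<Rightarrow> 1 | Vv \<Rightarrow> v0) f"
  unfolding line_def poly_subst by (rule arg_cong2[where f = eval]) (auto simp: fun_eq_iff split: var.split)

lemma line_altdef:
  "line v0 f = (\<Sum>m\<in>keys f. monom (lookup f m * v0 ^ lookup m Vv) (lookup m Vt))"
  unfolding line_def subst_def
  by (intro sum.cong refl)
    (simp add: UNIV_var monom_altdef poly_const_pow mult.commute)

lemma degree_line_le: "f \<in> bihom c d \<Longrightarrow> degree (line v0 f) \<le> c"
  unfolding line_altdef
  by (intro degree_sum_le) (auto simp: bihom_def intro!: order.trans[OF degree_monom_le])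

lemma coeff_line: 
  assumes "f \<in> bihom c d"
  shows "coeff (line v0 f) c = eval (\<lambda>i. case i of Vs \<Rightarrow> 0 | Vt \<Rightarrow> 1 | Vu \<Rightarrow> 1 | Vv \<Rightarrow> v0) f"
  unfolding line_altdef eval_def coeff_sum
  by (intro sum.cong refl) (use assms in \<open>auto simp: UNIV_var bihom_def power_0_left\<close>)

lemma exists_nonzero_value:
  fixes h :: "'k::alg_closed_field poly"
  assumes "h \<noteq> 0"
  shows "\<exists>z. poly h z \<noteq> 0"
proof -
  \<comment> \<open>A root \<open>z\<close> of \<open>X h - 1\<close> satisfies \<open>z h(z) = 1\<close>.\<close>
  obtain z where "poly (pCons (-1) h) z = 0"
    using alg_closed_imp_poly_has_root[of "pCons (-1) h"] assms by auto
  then show ?thesis by (intro exI[of _ z]) auto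
qed

text \<open>For some \<open>j\<close> the coefficient of \<open>t\<^sup>j\<close> on the line is a nonzero polynomial in \<open>v\<^sub>0\<close>, because a
  monomial of given bidegree is determined by its exponents of \<open>t\<close> and \<open>v\<close>.\<close>

lemma exists_line_ne_0:
  fixes f :: "'k::alg_closed_field R"
  assumes "f \<in> bihom c d" "f \<noteq> 0"
  shows "\<exists>v0. line v0 f \<noteq> 0"
proof -
  obtain m0 where m0: "m0 \<in> keys f" using assms(2) by fastforce
  define N where "N = {m \<in> keys f. lookup m Vt = lookup m0 Vt}"
  define h where "h = (\<Sum>m\<in>N. monom (lookup f m) (lookup m Vv))"
  have N: "finite N" by (simp add: N_def)
  have det: "m = m0" if "m \<in> N" "lookup m Vv = lookup m0 Vv" for m
  proof -
    have "m \<in> mons c d" "m0 \<in> mons c d"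
      using that(1) m0 assms(1) by (auto simp: N_def bihom_iff)
    then show ?thesis using that by (intro mon_eqI) (auto simp: N_def mons_def)
  qed
  have "coeff h (lookup m0 Vv) = (\<Sum>m\<in>N. if m = m0 then lookup f m else 0)"
    unfolding h_def coeff_sum by (intro sum.cong refl) (use det in auto)
  also have "\<dots> \<noteq> 0" using m0 N by (simp add: N_def in_keys_iff)
  finally have "h \<noteq> 0" by auto
  then obtain z where z: "poly h z \<noteq> 0" using exists_nonzero_value by blast
  have "coeff (line z f) (lookup m0 Vt) = (\<Sum>m\<in>keys f. if lookup m Vt = lookup m0 Vt
      then lookup f m * z ^ lookup m Vv else 0)"
    unfolding line_altdef coeff_sum by (intro sum.cong refl) auto
  also have "\<dots> = poly h z"
    by (auto simp: h_def N_def poly_sum poly_monom sum.inter_filter intro!: sum.cong)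
  finally show ?thesis using z by (intro exI[of _ z]) auto
qed

section \<open>Triples proportional to three forms without common zero\<close>

text \<open>Counted with multiplicity, \<open>\<beta>\<close> has fewer roots than \<open>p\<close>, so a root of \<open>p\<close> is left over that
  \<open>\<beta>\<close> cannot account for, and there \<open>x\<close> and \<open>y\<close> must vanish. The induction divides common roots of
  \<open>\<beta>\<close> and \<open>p\<close> out one at a time.\<close>

lemma common_zero_of_proportional:
  fixes p \<beta> x y c e :: "'k::alg_closed_field poly"
  assumes "\<beta> \<noteq> 0" "degree \<beta> < degree p" "\<beta> * x = p * c" "\<beta> * y = p * e"
  shows "\<exists>q. poly p q = 0 \<and> poly x q = 0 \<and> poly y q = 0"
  using assms
proof (induction "degree \<beta>" arbitrary: \<beta> p rule: less_induct)
  case less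
  obtain q where q: "poly p q = 0" using alg_closed_imp_poly_has_root[of p] less.prems by auto
  have eq: "poly \<beta> q * poly x q = 0" "poly \<beta> q * poly y q = 0"
    using less.prems(3,4) q by (metis mult_zero_left poly_mult)+
  show ?case
  proof (cases "poly \<beta> q = 0")
    case False
    then show ?thesis using eq q by auto
  next
    case True
    obtain \<beta>' p' where b: "\<beta> = [:-q, 1:] * \<beta>'" and p: "p = [:-q, 1:] * p'"
      using True q unfolding poly_eq_0_iff_dvd by (elim dvdE)
    have ne: "[:-q, 1:] \<noteq> 0" "\<beta>' \<noteq> 0" "p' \<noteq> 0" using b p less.prems by auto
    have deg: "degree \<beta> = Suc (degree \<beta>')" "degree p = Suc (degree p')"
      using degree_mult_eq[OF ne(1,2)] degree_mult_eq[OF ne(1,3)] by (simp_all add: b p)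
    have "[:-q, 1:] * (\<beta>' * x) = [:-q, 1:] * (p' * c)" "[:-q, 1:] * (\<beta>' * y) = [:-q, 1:] * (p' * e)"
      using less.prems(3,4) by (simp_all only: b p mult.assoc)
    then have "\<beta>' * x = p' * c" "\<beta>' * y = p' * e" using ne(1) by (metis mult_left_cancel)+
    with less.hyps[of \<beta>' p'] deg ne less.prems(2)
    obtain z where "poly p' z = 0 \<and> poly x z = 0 \<and> poly y z = 0" by auto
    then show ?thesis by (auto simp: p)
  qed
qed

text \<open>The equations make \<open>(\<beta>, \<beta>', \<beta>'')\<close> proportional to \<open>(p, x, y)\<close>. These three forms have no common
  factor, so the triple is a multiple of them and vanishes because its degree in \<open>s,t\<close> is too low.
  The proof avoids factorization. If \<open>\<beta> \<noteq> 0\<close>, restrict to a line on which \<open>\<beta>\<close> does not vanish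
  identically. On its projective closure \<open>p\<close> has \<open>a\<close> zeros and \<open>\<beta>\<close> only \<open>c < a\<close>, so some zero of \<open>p\<close> has
  larger multiplicity in \<open>p\<close> than in \<open>\<beta>\<close> and is a common zero of \<open>x\<close>, \<open>y\<close>, \<open>p\<close>. (If \<open>p\<close> vanishes on the whole
  line, then so do \<open>x\<close> and \<open>y\<close>.) An affine common zero is found if the affine degree of \<open>p\<close> exceeds that
  of \<open>\<beta>\<close>; otherwise the point at infinity is one.\<close>

lemma low_degree_relation_zero:
  fixes x y p \<beta> \<beta>' \<beta>'' :: "'k::alg_closed_field R"
  assumes x: "x \<in> bihom a d" and y: "y \<in> bihom a d'" and p: "p \<in> bihom a d''" and "p \<noteq> 0"
    and nz: "\<And>P. P Vs \<noteq> 0 \<or> P Vt \<noteq> 0 \<Longrightarrow> P Vu \<noteq> 0 \<or> P Vv \<noteq> 0 \<Longrightarrow>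
      \<not> (eval P x = 0 \<and> eval P y = 0 \<and> eval P p = 0)"
    and b: "\<beta> \<in> bihom c e" "\<beta>' \<in> bihom c e'" "\<beta>'' \<in> bihom c e''" and "c < a"
    and eq: "\<beta> * x = p * \<beta>'" "\<beta> * y = p * \<beta>''"
  shows "\<beta> = 0 \<and> \<beta>' = 0 \<and> \<beta>'' = 0"
proof (cases "\<beta> = 0")
  case True
  then show ?thesis using eq \<open>p \<noteq> 0\<close> by simp
next
  case False
  obtain v0 where v0: "line v0 \<beta> \<noteq> 0" using exists_line_ne_0[OF b(1) False] by blast
  have eq': "line v0 \<beta> * line v0 x = line v0 p * line v0 \<beta>'"
    "line v0 \<beta> * line v0 y = line v0 p * line v0 \<beta>''"
    using eq by (metis line_mult)+
  have at_infinity: "coeff (line v0 z) a = 0"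
    if le: "degree (line v0 p) \<le> degree (line v0 \<beta>)" and z: "z \<in> bihom a d1"
      and g: "g \<in> bihom c d2" and zg: "line v0 \<beta> * line v0 z = line v0 p * line v0 g" for z g d1 d2
  proof (rule ccontr)
    assume nz: "coeff (line v0 z) a \<noteq> 0"
    then have deg: "degree (line v0 z) = a" using degree_line_le[OF z] le_degree le_antisym by metis
    have "line v0 z \<noteq> 0" using nz by auto
    then have "line v0 p * line v0 g \<noteq> 0" using zg v0 by (metis mult_eq_0_iff)
    then have "degree (line v0 \<beta>) + a = degree (line v0 p) + degree (line v0 g)"
      using arg_cong[OF zg, of degree] v0 \<open>line v0 z \<noteq> 0\<close> by (auto simp: degree_mult_eq deg)
    then show False using le degree_line_le[OF g, of v0] \<open>c < a\<close> by simp
  qed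
  show ?thesis
  proof (cases "degree (line v0 \<beta>) < degree (line v0 p)")
    case True
    then obtain q where "poly (line v0 p) q = 0" "poly (line v0 x) q = 0" "poly (line v0 y) q = 0"
      using common_zero_of_proportional[OF v0 _ eq'] by blast
    then show ?thesis
      using nz[of "\<lambda>i. case i of Vs \<Rightarrow> 1 | Vt \<Rightarrow> q | Vu \<Rightarrow> 1 | Vv \<Rightarrow> v0"] by (simp add: poly_line)
  next
    case False
    then have "degree (line v0 p) < a" using degree_line_le[OF b(1), of v0] \<open>c < a\<close> by simp
    then have "coeff (line v0 p) a = 0" by (rule coeff_eq_0)
    moreover have "coeff (line v0 x) a = 0" "coeff (line v0 y) a = 0"
      using at_infinity False x y b eq' by (meson not_less)+
    ultimately show ?thesis
      using nz[of "\<lambda>i. case i of Vs \<Rightarrow> 0 | Vt \<Rightarrow> 1 | Vu \<Rightarrow> 1 | Vv \<Rightarrow> v0"]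
      by (simp add: coeff_line[OF x] coeff_line[OF y] coeff_line[OF p])
  qed
qed

section \<open>Dimensions of spaces of tuples of forms\<close>

text \<open>Scalar multiplication on tuples of any length: the dimension count behind the lifting of the
  Koszul relations compares triples with pairs.\<close>

definition vscale :: "'k::field \<Rightarrow> 'k R ^ 'n \<Rightarrow> 'k R ^ 'n" where
  "vscale c T = const c *s T"

interpretation VR: vector_space "vscale :: 'k::field \<Rightarrow> 'k R ^ 'n \<Rightarrow> 'k R ^ 'n"
  by standard
    (simp_all add: vscale_def const_add const_mult const_one vec_eq_iff algebra_simps)

lemma kscale4_eq_vscale: "kscale4 = vscale"
  by (simp add: fun_eq_iff kscale4_def vscale_def)

definition supported_in :: "('n \<Rightarrow> mon set) \<Rightarrow> ('k::zero R ^ 'n) set" where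
  "supported_in N = {T. \<forall>i. keys (T $ i) \<subseteq> N i}"

definition unit_monomial :: "'n \<times> mon \<Rightarrow> 'k::field R ^ 'n" where
  "unit_monomial = (\<lambda>(i, m). axis i (single m 1))"

lemma inj_unit_monomial: "inj (unit_monomial :: 'n \<times> mon \<Rightarrow> 'k::field R ^ 'n)"
proof (rule injI, clarsimp simp: unit_monomial_def)
  fix i j :: 'n and m m' :: mon
  assume "axis i (single m (1 :: 'k)) = axis j (single m' 1)"
  moreover have "single m (1 :: 'k) \<noteq> 0" for m :: mon
    by (metis lookup_single_eq lookup_zero zero_neq_one)
  ultimately have "i = j \<and> single m (1 :: 'k) = single m' 1"
    unfolding axis_eq_axis by blast
  then show "i = j \<and> m = m'"
    by (metis lookup_single_eq lookup_single_not_eq zero_neq_one)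
qed

lemma lookup_unit_monomial_sum:
  fixes h :: "('n::finite) \<times> mon \<Rightarrow> 'k::field"
  assumes "\<And>i. finite (N i)"
  shows "lookup ((\<Sum>e\<in>Sigma UNIV N. vscale (h e) (unit_monomial e)) $ i) m
    = (h (i, m) when m \<in> N i)"
proof -
  have "lookup ((\<Sum>e\<in>Sigma UNIV N. vscale (h e) (unit_monomial e)) $ i) m
    = (\<Sum>e\<in>Sigma UNIV N. if e = (i, m) then h e else 0)"
    unfolding sum_component lookup_sum
    by (intro sum.cong refl)
      (auto simp: vscale_def unit_monomial_def axis_def const_def mult_single lookup_single when_def
        split: if_splits)
  also have "\<dots> = (h (i, m) when m \<in> N i)"
    using assms by (subst sum.delta) (auto simp: when_def)
  finally show ?thesis .
qed

lemma independent_unit_monomials: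
  assumes "\<And>i. finite (N i)"
  shows "VR.independent (unit_monomial ` Sigma (UNIV :: 'n::finite set) N :: ('k::field R ^ 'n) set)"
proof (rule VR.independent_if_scalars_zero)
  show "finite (unit_monomial ` Sigma (UNIV :: 'n set) N)" using assms by auto
next
  fix f :: "'k R ^ 'n \<Rightarrow> 'k" and x :: "'k R ^ 'n"
  assume "(\<Sum>x\<in>unit_monomial ` Sigma UNIV N. vscale (f x) x) = 0"
    and x: "x \<in> unit_monomial ` Sigma UNIV N"
  then have *: "(\<Sum>e\<in>Sigma UNIV N. vscale (f (unit_monomial e)) (unit_monomial e :: 'k R ^ 'n)) = 0"
    by (subst (asm) sum.reindex) (auto intro: inj_on_subset[OF inj_unit_monomial] simp: o_def)
  obtain i m where "x = unit_monomial (i, m)" "m \<in> N i" using x by auto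
  then show "f x = 0"
    using lookup_unit_monomial_sum[of N "\<lambda>e. f (unit_monomial e)" i m, OF assms] by (simp add: *)
qed

lemma span_unit_monomials:
  assumes "\<And>i. finite (N i)"
  shows "VR.span (unit_monomial ` Sigma (UNIV :: 'n::finite set) N)
    = (supported_in N :: ('k::field R ^ 'n) set)" (is "VR.span ?E = _")
proof
  have "VR.subspace (supported_in N :: ('k R ^ 'n) set)"
    unfolding VR.subspace_def supported_in_def
  proof (safe, goal_cases)
    case (2 S T i m)
    then show ?case using keys_add[of "S $ i" "T $ i"] by (auto dest!: subsetD)
  next
    case (3 c T i m)
    then have "m \<in> keys (const c * T $ i)" by (simp add: vscale_def)
    then have "m \<in> keys (T $ i)"
      using keys_mult[of "const c" "T $ i"] by (auto simp: const_def split: if_splits)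
    then show ?case using 3 by auto
  qed simp
  moreover have "?E \<subseteq> supported_in N"
    by (auto simp: unit_monomial_def supported_in_def axis_def split: if_splits)
  ultimately show "VR.span ?E \<subseteq> supported_in N" by (rule VR.span_minimal[rotated])
  show "supported_in N \<subseteq> VR.span ?E"
  proof
    fix T :: "'k R ^ 'n" assume T: "T \<in> supported_in N"
    define W where "W = (\<Sum>e\<in>Sigma UNIV N. vscale (lookup (T $ fst e) (snd e)) (unit_monomial e))"
    have "lookup (T $ i) m = lookup (W $ i) m" for i m
    proof -
      have "lookup (T $ i) m = 0" if "m \<notin> N i"
      proof -
        have "keys (T $ i) \<subseteq> N i" using T by (simp add: supported_in_def)
        then show ?thesis using that by (meson in_keys_iff subsetD)
      qed
      then show ?thesis
        unfolding W_def by (subst lookup_unit_monomial_sum[OF assms]) (simp add: when_def)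
    qed
    then have "T = W" by (simp add: vec_eq_iff poly_mapping_eqI)
    also have "\<dots> \<in> VR.span ?E"
      unfolding W_def by (intro VR.span_sum VR.span_scale VR.span_base) auto
    finally show "T \<in> VR.span ?E" .
  qed
qed

lemma card_unit_monomials:
  assumes "\<And>i. finite (N i)"
  shows "card (unit_monomial ` Sigma (UNIV :: 'n::finite set) N :: ('k::field R ^ 'n) set)
    = (\<Sum>i\<in>UNIV. card (N i))"
  using assms by (subst card_image) (auto intro: inj_on_subset[OF inj_unit_monomial])

text \<open>A basis of monomials is mapped to an independent family which is as large as the monomial basis
  of the target.\<close>

lemma injective_image_supported_in:
  fixes L :: "'k::field R ^ ('n::finite) \<Rightarrow> 'k R ^ ('m::finite)"
  assumes L: "Vector_Spaces.linear vscale vscale L"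
    and inj: "inj_on L (supported_in N)" and sub: "L ` supported_in N \<subseteq> supported_in M"
    and fin: "\<And>i. finite (N i)" "\<And>i. finite (M i)"
    and card: "(\<Sum>i\<in>UNIV. card (N i)) = (\<Sum>i\<in>UNIV. card (M i))"
  shows "L ` supported_in N = supported_in M"
proof -
  interpret L: Vector_Spaces.linear vscale vscale L by (rule L)
  let ?E = "unit_monomial ` Sigma UNIV N :: ('k R ^ 'n) set"
  let ?E' = "unit_monomial ` Sigma UNIV M :: ('k R ^ 'm) set"
  have spanE: "VR.span ?E = supported_in N" and spanE': "VR.span ?E' = supported_in M"
    using fin by (simp_all add: span_unit_monomials)
  have fin': "finite ?E" "finite ?E'" using fin by auto
  have img: "VR.span (L ` ?E) = L ` supported_in N" by (simp add: L.span_image spanE)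
  have ind: "VR.independent (L ` ?E)"
    using L.independent_injective_image[OF independent_unit_monomials] inj fin(1) by (simp add: spanE)
  have cardLE: "card (L ` ?E) = card ?E'"
    using inj VR.span_superset[of ?E] unfolding spanE
    by (subst card_image) (auto intro: inj_on_subset simp: card_unit_monomials fin card)
  have "z \<in> VR.span (L ` ?E)" if z: "z \<in> supported_in M" for z
  proof (rule ccontr)
    assume nz: "z \<notin> VR.span (L ` ?E)"
    then have "VR.independent (insert z (L ` ?E))" using ind VR.independent_insertI by blast
    moreover have "L ` ?E \<subseteq> supported_in M"
      using image_mono[OF VR.span_superset[of ?E], of L] sub unfolding spanE by (rule order.trans)
    then have "insert z (L ` ?E) \<subseteq> VR.span ?E'" using z unfolding spanE' by simp
    ultimately have "card (insert z (L ` ?E)) \<le> card ?E'"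
      using VR.independent_span_bound[OF fin'(2)] by blast
    moreover have "z \<notin> L ` ?E" using nz by (rule contrapos_nn) (rule VR.span_base)
    ultimately show False using fin'(1) cardLE by simp
  qed
  then show ?thesis using sub img by blast
qed

lemma dim_injective_image_supported_in:
  fixes L :: "'k::field R ^ ('n::finite) \<Rightarrow> 'k R ^ ('m::finite)"
  assumes L: "Vector_Spaces.linear vscale vscale L"
    and inj: "inj_on L (supported_in N)" and fin: "\<And>i. finite (N i)"
  shows "VR.dim (L ` supported_in N) = (\<Sum>i\<in>UNIV. card (N i))"
proof -
  interpret L: Vector_Spaces.linear vscale vscale L by (rule L)
  let ?E = "unit_monomial ` Sigma UNIV N :: ('k R ^ 'n) set"
  have spanE: "VR.span ?E = supported_in N" using fin by (rule span_unit_monomials)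
  have "VR.independent (L ` ?E)"
    using L.independent_injective_image[OF independent_unit_monomials] inj fin(1) by (simp add: spanE)
  then have "VR.dim (L ` supported_in N) = card (L ` ?E)"
    by (intro VR.dim_eq_card) (simp_all add: L.span_image VR.span_span flip: spanE)
  also have "\<dots> = card ?E"
    using inj VR.span_superset[of ?E] unfolding spanE by (intro card_image) (auto intro: inj_on_subset)
  finally show ?thesis using fin by (simp add: card_unit_monomials)
qed

lemma linear_injI:
  fixes L :: "'k::field R ^ 'n \<Rightarrow> 'k R ^ 'm"
  assumes add: "\<And>T T'. L (T + T') = L T + L T'" and scale: "\<And>c T. L (const c *s T) = const c *s L T"
    and ker: "\<And>T. T \<in> supported_in N \<Longrightarrow> L T = 0 \<Longrightarrow> T = 0"
  shows "Vector_Spaces.linear vscale vscale L" "inj_on L (supported_in N)"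
proof -
  show lin: "Vector_Spaces.linear vscale vscale L"
    by unfold_locales (simp_all add: add vscale_def scale)
  interpret L: Vector_Spaces.linear vscale vscale L by (rule lin)
  show "inj_on L (supported_in N)"
  proof (rule inj_onI)
    fix T T' assume "T \<in> supported_in N" "T' \<in> supported_in N" "L T = L T'"
    moreover from this have "T - T' \<in> supported_in N"
      using keys_diff by (fastforce simp: supported_in_def)
    ultimately show "T = T'" using ker[of "T - T'"] by (simp add: L.diff)
  qed
qed

section \<open>Consequences of the resolution of the ideal of the syzygy's entries\<close>

definition dot :: "'r::comm_ring_1 ^ 'n \<Rightarrow> 'r ^ 'n \<Rightarrow> 'r" where
  "dot w v = (\<Sum>i\<in>UNIV. w $ i * v $ i)"

lemma dot_add_left: "dot (w + w') v = dot w v + dot w' v"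
  by (simp add: dot_def distrib_right sum.distrib)

lemma dot_smult_left: "dot (c *s w) v = c * dot w v"
  by (simp add: dot_def sum_distrib_left mult.assoc)

lemma dot_commute: "dot w v = dot v w"
  by (simp add: dot_def mult.commute)

lemma dot_add_right: "dot v (w + w') = dot v w + dot v w'"
  and dot_smult_right: "dot v (c *s w) = c * dot v w"
  by (simp_all add: dot_commute[of v] dot_add_left dot_smult_left)

lemma dot_in_bihom:
  fixes w v :: "'k::comm_ring_1 R ^ 'n"
  shows "(\<And>i. w $ i \<in> bihom c d) \<Longrightarrow> (\<And>i. v $ i \<in> bihom c' d') \<Longrightarrow> dot w v \<in> bihom (c + c') (d + d')"
  unfolding dot_def by (intro bihom_sum bihom_mult)

lemma one_in_bihom: "(1 :: 'k::comm_ring_1 R) \<in> bihom 0 0"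
  using bihom_const[of "1 :: 'k"] by (simp add: const_def)

lemma X_st_power_in_bihom: "i \<in> {Vs, Vt} \<Longrightarrow> X i ^ c \<in> bihom c 0"
proof (induction c)
  case 0
  show ?case by (simp add: one_in_bihom)
next
  case (Suc c)
  then show ?case using bihom_mult[OF X_st_in_bihom[of i] Suc.IH] by simp
qed

text \<open>\<open>R\<close> is a free \<open>A\<close>-module on the monomials in \<open>s,t\<close>, so a syzygy of \<open>g\<close> over \<open>R\<close> is a tuple of syzygies
  over \<open>A\<close>, one for each monomial, and each of them is a combination of \<open>P\<close> and \<open>Q\<close>.\<close>

lemma syzygies_over_A_extend:
  fixes g P Q F :: "'k::idom R ^ 'n"
  assumes exact: "\<And>w. (\<And>k. w $ k \<in> A_ring) \<Longrightarrow> dot w g = 0 \<Longrightarrow>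
      \<exists>x\<in>A_ring. \<exists>y\<in>A_ring. w = x *s P + y *s Q"
    and g: "\<And>k. g $ k \<in> bihom 0 n" and P: "\<And>k. P $ k \<in> bihom 0 \<mu>" and Q: "\<And>k. Q $ k \<in> bihom 0 \<nu>"
    and le: "\<mu> \<le> b" "\<nu> \<le> b"
    and F: "\<And>k. F $ k \<in> bihom a b" and "dot F g = 0"
  shows "\<exists>x\<in>bihom a (b - \<mu>). \<exists>y\<in>bihom a (b - \<nu>). F = x *s P + y *s Q"
proof -
  have base: "\<exists>x\<in>bihom 0 (b - \<mu>). \<exists>y\<in>bihom 0 (b - \<nu>). H = x *s P + y *s Q"
    if H: "\<And>k. H $ k \<in> bihom 0 b" "dot H g = 0" for H
  proof -
    obtain x y where xy: "H = x *s P + y *s Q"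
      using exact[of H] H bihom_0_subset_A_ring by blast
    \<comment> \<open>The resolution is graded: homogeneous components of \<open>x\<close> and \<open>y\<close> do as well.\<close>
    have "H $ k = bicomp 0 (b - \<mu>) x * P $ k + bicomp 0 (b - \<nu>) y * Q $ k" for k
    proof -
      have "H $ k = bicomp 0 b (x * P $ k) + bicomp 0 b (y * Q $ k)"
        using bicomp_bihom[OF H(1), of 0 b k] by (simp add: xy bicomp_add)
      then show ?thesis
        using bicomp_mult_bihom[OF P, of 0 "b - \<mu>" x k] bicomp_mult_bihom[OF Q, of 0 "b - \<nu>" y k] le
        by simp
    qed
    then show ?thesis
      by (intro bexI[of _ "bicomp 0 (b - \<mu>) x"] bexI[of _ "bicomp 0 (b - \<nu>) y"] bicomp_in_bihom)
        (simp add: vec_eq_iff)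
  qed
  show ?thesis using F \<open>dot F g = 0\<close>
  proof (induction a arbitrary: F)
    case 0
    then show ?case by (intro base)
  next
    case (Suc a)
    have "\<forall>k. \<exists>f h. f \<in> bihom a b \<and> h \<in> bihom 0 b \<and> F $ k = X Vs * f + X Vt ^ Suc a * h"
      using bihom_mod_s[OF Suc.prems(1)] by blast
    then obtain f h where fh: "\<And>k. f k \<in> bihom a b" "\<And>k. h k \<in> bihom 0 b"
      "\<And>k. F $ k = X Vs * f k + X Vt ^ Suc a * h k" by metis
    define F' H where "F' = (\<chi> k. f k)" and "H = (\<chi> k. h k)"
    have F: "F = X Vs *s F' + X Vt ^ Suc a *s H" by (simp add: vec_eq_iff F'_def H_def fh)
    have mem: "\<And>k. F' $ k \<in> bihom a b" "\<And>k. H $ k \<in> bihom 0 b" by (simp_all add: F'_def H_def fh)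
    have "X Vs * dot F' g + X Vt ^ Suc a * dot H g = 0"
      using Suc.prems(2) by (simp add: F dot_add_left dot_smult_left)
    moreover have "dot H g \<in> bihom 0 (b + n)" using dot_in_bihom[OF mem(2) g] by simp
    ultimately have "dot F' g = 0 \<and> dot H g = 0" by (rule s_t_independent)
    then obtain x' y' x0 y0 where
      x: "x' \<in> bihom a (b - \<mu>)" "x0 \<in> bihom 0 (b - \<mu>)" and
      y: "y' \<in> bihom a (b - \<nu>)" "y0 \<in> bihom 0 (b - \<nu>)" and
      eq: "F' = x' *s P + y' *s Q" "H = x0 *s P + y0 *s Q"
      using Suc.IH[OF mem(1)] base[OF mem(2)] by blast
    have comb: "X Vs * z' + X Vt ^ Suc a * z0 \<in> bihom (Suc a) e"
      if "z' \<in> bihom a e" "z0 \<in> bihom 0 e" for z' z0 :: "'k R" and e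
      using bihom_add[OF bihom_mult[OF X_st_in_bihom that(1)]]
        bihom_mult[OF X_st_power_in_bihom[of Vt "Suc a"] that(2)]
      by (metis One_nat_def add.left_neutral add.right_neutral insertCI plus_1_eq_Suc)
    have "F = (X Vs * x' + X Vt ^ Suc a * x0) *s P + (X Vs * y' + X Vt ^ Suc a * y0) *s Q"
      by (simp add: F eq vec_eq_iff algebra_simps)
    then show ?case using comb[OF x] comb[OF y] by blast
  qed
qed

text \<open>The pairing with \<open>P\<close> and \<open>Q\<close> turns a triple of forms of degree \<open>e\<close> into a pair of forms of degrees
  \<open>e + \<mu>\<close> and \<open>e + \<nu>\<close>. For \<open>e = \<mu> + \<nu> - 1\<close> source and target have the same dimension, so injectivity
  is enough.\<close>

lemma pairing_surjective_at_bound: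
  fixes P Q :: "'k::field R ^ 3"
  assumes P: "\<And>k. P $ k \<in> bihom 0 \<mu>" and Q: "\<And>k. Q $ k \<in> bihom 0 \<nu>"
    and inj: "\<And>w. (\<And>k. w $ k \<in> bihom 0 e) \<Longrightarrow> dot w P = 0 \<Longrightarrow> dot w Q = 0 \<Longrightarrow> w = 0"
    and e: "Suc e = \<mu> + \<nu>"
    and h: "h \<in> bihom 0 (e + \<mu>)" "h' \<in> bihom 0 (e + \<nu>)"
  shows "\<exists>w. (\<forall>k. w $ k \<in> bihom 0 e) \<and> dot w P = h \<and> dot w Q = h'"
proof -
  define N :: "3 \<Rightarrow> mon set" where "N = (\<lambda>_. mons 0 e)"
  define M :: "2 \<Rightarrow> mon set" where "M = (\<lambda>i. if i = 1 then mons 0 (e + \<mu>) else mons 0 (e + \<nu>))"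
  define L :: "'k R ^ 3 \<Rightarrow> 'k R ^ 2" where "L = (\<lambda>w. \<chi> i. if i = 1 then dot w P else dot w Q)"
  have memN: "w \<in> supported_in N \<longleftrightarrow> (\<forall>k. w $ k \<in> bihom 0 e)" for w :: "'k R ^ 3"
    by (simp add: supported_in_def N_def bihom_iff)
  have memM: "v \<in> supported_in M \<longleftrightarrow> v $ 1 \<in> bihom 0 (e + \<mu>) \<and> v $ 2 \<in> bihom 0 (e + \<nu>)"
    for v :: "'k R ^ 2" by (simp add: supported_in_def M_def bihom_iff forall_2)
  have ker: "T = 0" if "T \<in> supported_in N" "L T = 0" for T
    using that inj[of T] unfolding memN by (simp add: L_def vec_eq_iff forall_2)
  have L: "L (T + T') = L T + L T'" "L (const c *s T) = const c *s L T" for T T' c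
    by (auto simp: L_def vec_eq_iff dot_add_left dot_smult_left)
  note lin = linear_injI[OF L ker]
  have "L ` supported_in N \<subseteq> supported_in M"
    using dot_in_bihom[OF _ P, of _ 0 e] dot_in_bihom[OF _ Q, of _ 0 e]
    unfolding image_subset_iff Ball_def memN memM by (simp add: L_def)
  \<comment> \<open>Both sides have dimension \<open>3 (e + 1) = (e + \<mu> + 1) + (e + \<nu> + 1)\<close>.\<close>
  moreover have "(\<Sum>i\<in>UNIV. card (N i)) = (\<Sum>i\<in>UNIV. card (M i))"
    using e by (simp add: N_def M_def sum_3 sum_2)
  ultimately have "L ` supported_in N = supported_in M"
    using lin by (intro injective_image_supported_in) (auto simp: N_def M_def)
  moreover have "vector [h, h'] \<in> supported_in M" using h by (simp add: memM)
  ultimately obtain w where "w \<in> supported_in N" "L w = vector [h, h']" by (metis imageE)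
  then show ?thesis unfolding memN by (intro exI[of _ w]) (auto simp: L_def vec_eq_iff forall_2)
qed

text \<open>Surjectivity propagates to higher degrees because forms of positive degree are
  combinations of the variables with coefficients of one degree less.\<close>

lemma pairing_surjective:
  fixes P Q :: "'k::field R ^ 3"
  assumes P: "\<And>k. P $ k \<in> bihom 0 \<mu>" and Q: "\<And>k. Q $ k \<in> bihom 0 \<nu>"
    and inj: "\<And>w. (\<And>k. w $ k \<in> bihom 0 e) \<Longrightarrow> dot w P = 0 \<Longrightarrow> dot w Q = 0 \<Longrightarrow> w = 0"
    and e: "Suc e = \<mu> + \<nu>" and "e \<le> d"
    and h: "h \<in> bihom c (d + \<mu>)" "h' \<in> bihom c (d + \<nu>)"
  shows "\<exists>w. (\<forall>k. w $ k \<in> bihom c d) \<and> dot w P = h \<and> dot w Q = h'"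
  using h
proof (induction c arbitrary: h h')
  case 0
  from \<open>e \<le> d\<close> 0 show ?case
  proof (induction d arbitrary: h h' rule: dec_induct)
    case base
    then show ?case using pairing_surjective_at_bound[OF P Q inj e] by blast
  next
    case (step d)
    obtain k l where k: "k \<in> bihom 0 (d + \<mu>)" "l \<in> bihom 0 (d + \<mu>)" "h = X Vu * k + X Vv * l"
      using bihom_split_uv[of h 0 "d + \<mu>"] step.prems by auto
    obtain k' l' where k': "k' \<in> bihom 0 (d + \<nu>)" "l' \<in> bihom 0 (d + \<nu>)" "h' = X Vu * k' + X Vv * l'"
      using bihom_split_uv[of h' 0 "d + \<nu>"] step.prems by auto
    obtain w w' where
      w: "\<And>i. w $ i \<in> bihom 0 d" "dot w P = k" "dot w Q = k'" and
      w': "\<And>i. w' $ i \<in> bihom 0 d" "dot w' P = l" "dot w' Q = l'"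
      using step.IH[OF k(1) k'(1)] step.IH[OF k(2) k'(2)] by blast
    have "(X Vu *s w + X Vv *s w') $ i \<in> bihom 0 (Suc d)" for i
      using bihom_add[OF bihom_mult[OF X_uv_in_bihom w(1)] bihom_mult[OF X_uv_in_bihom w'(1)], of Vu Vv i i]
      by simp
    then show ?case using k(3) k'(3) w w'
      by (intro exI[of _ "X Vu *s w + X Vv *s w'"]) (simp add: dot_add_left dot_smult_left)
  qed
next
  case (Suc c)
  obtain k l where k: "k \<in> bihom c (d + \<mu>)" "l \<in> bihom c (d + \<mu>)" "h = X Vs * k + X Vt * l"
    using bihom_split_st[OF Suc.prems(1)] by auto
  obtain k' l' where k': "k' \<in> bihom c (d + \<nu>)" "l' \<in> bihom c (d + \<nu>)" "h' = X Vs * k' + X Vt * l'"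
    using bihom_split_st[OF Suc.prems(2)] by auto
  obtain w w' where
    w: "\<And>i. w $ i \<in> bihom c d" "dot w P = k" "dot w Q = k'" and
    w': "\<And>i. w' $ i \<in> bihom c d" "dot w' P = l" "dot w' Q = l'"
    using Suc.IH[OF k(1) k'(1)] Suc.IH[OF k(2) k'(2)] by blast
  have "(X Vs *s w + X Vt *s w') $ i \<in> bihom (Suc c) d" for i
    using bihom_add[OF bihom_mult[OF X_st_in_bihom w(1)] bihom_mult[OF X_st_in_bihom w'(1)], of Vs Vt i i]
    by simp
  then show ?case using k(3) k'(3) w w'
    by (intro exI[of _ "X Vs *s w + X Vt *s w'"]) (simp add: dot_add_left dot_smult_left)
qed

section \<open>The three syzygies in adapted coordinates\<close>

text \<open>Here \<open>F\<close> is a basis of \<open>V\<close> and \<open>q\<close> completes it to generators of \<open>I\<^sub>U\<close>; a syzygy is a pair of a triple \<open>w\<close>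
  and a form \<open>h\<close>, and \<open>S\<close> is the pair of \<open>g\<close> and \<open>0\<close>. Since \<open>g\<close> is a syzygy of \<open>F\<close>, conversely \<open>F\<close> is one of \<open>g\<close>,
  so \<open>F = x P + y Q\<close>. Thus \<open>(w, h)\<close> is a syzygy exactly if \<open>(w\<cdot>P, w\<cdot>Q, h)\<close> is a syzygy of \<open>x, y, q\<close>, and the
  three syzygies are lifts of the Koszul relations \<open>(y, -x, 0)\<close>, \<open>(0, q, -y)\<close>, \<open>(q, 0, -x)\<close>. The lifts
  exist since all degrees in question are at least \<open>b - n \<ge> n - 1\<close>, where the pairing is surjective;
  it is injective in degree \<open>n - 1\<close> because a triple in its kernel is a syzygy of \<open>F\<close> of degree
  less than \<open>n\<close>.\<close>

lemma adapted_syzygies: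
  fixes F g P Q :: "'k::alg_closed_field R ^ 3" and q :: "'k R"
  assumes exact: "\<And>w. (\<And>k. w $ k \<in> A_ring) \<Longrightarrow> dot w g = 0 \<Longrightarrow>
      \<exists>x\<in>A_ring. \<exists>y\<in>A_ring. w = x *s P + y *s Q"
    and PQ: "dot P g = 0" "dot Q g = 0"
    and g: "\<And>k. g $ k \<in> bihom 0 n" "g \<noteq> 0"
    and P: "\<And>k. P $ k \<in> bihom 0 \<mu>" and Q: "\<And>k. Q $ k \<in> bihom 0 \<nu>"
    and n: "n = \<mu> + \<nu>" "0 < n" "2 * n \<le> Suc b" and "0 < a"
    and F: "\<And>k. F $ k \<in> bihom a b" "dot F g = 0" and q: "q \<in> bihom a b" "q \<noteq> 0"
    and minimal: "\<And>w. (\<And>k. w $ k \<in> bihom 0 (n - 1)) \<Longrightarrow> dot w F = 0 \<Longrightarrow> w = 0"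
    and nz: "\<And>x. x Vs \<noteq> 0 \<or> x Vt \<noteq> 0 \<Longrightarrow> x Vu \<noteq> 0 \<or> x Vv \<noteq> 0 \<Longrightarrow> (\<And>k. eval x (F $ k) = 0) \<Longrightarrow>
      eval x q \<noteq> 0"
  shows "\<exists>w1 w2 w3 h2 h3.
    (\<forall>k. w1 $ k \<in> bihom a (b - n)) \<and> dot w1 F = 0 \<and>
    (\<forall>k. w2 $ k \<in> bihom a (b - \<nu>)) \<and> h2 \<in> bihom a (b - \<nu>) \<and> dot w2 F + h2 * q = 0 \<and>
    (\<forall>k. w3 $ k \<in> bihom a (b - \<mu>)) \<and> h3 \<in> bihom a (b - \<mu>) \<and> dot w3 F + h3 * q = 0 \<and>
    (\<forall>\<alpha> \<beta>1 \<beta>2 \<beta>3. \<beta>1 \<in> bihom (a - 1) (n - 1) \<longrightarrow> \<beta>2 \<in> bihom (a - 1) (\<nu> - 1) \<longrightarrow>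
      \<beta>3 \<in> bihom (a - 1) (\<mu> - 1) \<longrightarrow> \<alpha> *s g + \<beta>1 *s w1 + \<beta>2 *s w2 + \<beta>3 *s w3 = 0 \<longrightarrow>
      \<beta>2 * h2 + \<beta>3 * h3 = 0 \<longrightarrow> \<alpha> = 0 \<and> \<beta>1 = 0 \<and> \<beta>2 = 0 \<and> \<beta>3 = 0)"
proof -
  have le: "\<mu> \<le> b" "\<nu> \<le> b" "n \<le> b" using n by auto
  have "\<exists>x\<in>bihom a (b - \<mu>). \<exists>y\<in>bihom a (b - \<nu>). F = x *s P + y *s Q"
    by (rule syzygies_over_A_extend[OF _ g(1) P Q le(1,2) F]) (rule exact)
  then obtain x y where x: "x \<in> bihom a (b - \<mu>)" and y: "y \<in> bihom a (b - \<nu>)"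
    and Fxy: "F = x *s P + y *s Q"
    by (elim bexE)
  have dotF: "dot w F = x * dot w P + y * dot w Q" for w
    by (simp add: Fxy dot_add_right dot_smult_right)
  have inj: "w = 0" if "\<And>k. w $ k \<in> bihom 0 (n - 1)" "dot w P = 0" "dot w Q = 0" for w
    using that by (intro minimal) (simp_all add: dotF)
  have lift: "\<exists>w. (\<forall>k. w $ k \<in> bihom a d) \<and> dot w P = h \<and> dot w Q = h'"
    if "n - 1 \<le> d" "h \<in> bihom a (d + \<mu>)" "h' \<in> bihom a (d + \<nu>)" for d h h'
    by (rule pairing_surjective[OF P Q _ _ that], rule inj) (use n in auto)
  have d: "b - n + \<mu> = b - \<nu>" "b - n + \<nu> = b - \<mu>" "n - 1 \<le> b - n"
    "n - 1 \<le> b - \<mu>" "n - 1 \<le> b - \<nu>" "b - \<mu> + \<mu> = b" "b - \<nu> + \<nu> = b" using n by auto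
  obtain w1 where w1: "\<forall>k. w1 $ k \<in> bihom a (b - n)" "dot w1 P = y" "dot w1 Q = - x"
    using lift[OF d(3), of y "- x", unfolded d, OF y bihom_uminus[OF x]] by blast
  obtain w2 where w2: "\<forall>k. w2 $ k \<in> bihom a (b - \<nu>)" "dot w2 P = 0" "dot w2 Q = q"
    using lift[OF d(5), of 0 q, unfolded d, OF bihom_zero q(1)] by blast
  obtain w3 where w3: "\<forall>k. w3 $ k \<in> bihom a (b - \<mu>)" "dot w3 P = q" "dot w3 Q = 0"
    using lift[OF d(4), of q 0, unfolded d, OF q(1) bihom_zero] by blast
  have indep: "\<alpha> = 0 \<and> \<beta>1 = 0 \<and> \<beta>2 = 0 \<and> \<beta>3 = 0"
    if b: "\<beta>1 \<in> bihom (a - 1) (n - 1)" "\<beta>2 \<in> bihom (a - 1) (\<nu> - 1)" "\<beta>3 \<in> bihom (a - 1) (\<mu> - 1)"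
      and rel: "\<alpha> *s g + \<beta>1 *s w1 + \<beta>2 *s w2 + \<beta>3 *s w3 = 0" for \<alpha> \<beta>1 \<beta>2 \<beta>3
  proof -
    \<comment> \<open>Pairing with \<open>P\<close> and \<open>Q\<close> kills the multiple of \<open>g\<close> and leaves a relation among \<open>x, y, q\<close>.\<close>
    have "dot (\<alpha> *s g + \<beta>1 *s w1 + \<beta>2 *s w2 + \<beta>3 *s w3) v = 0" for v
      by (simp add: rel dot_def)
    from this[of P] this[of Q] have "\<beta>1 * y + \<beta>3 * q = 0" "- (\<beta>1 * x) + \<beta>2 * q = 0"
      using PQ by (simp_all add: dot_add_left dot_smult_left dot_commute[of g] w1 w2 w3)
    then have eq: "\<beta>1 * x = q * \<beta>2" "\<beta>1 * y = q * (- \<beta>3)"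
      by (simp_all add: algebra_simps eq_neg_iff_add_eq_0)
    have nz': "\<not> (eval z x = 0 \<and> eval z y = 0 \<and> eval z q = 0)"
      if "z Vs \<noteq> 0 \<or> z Vt \<noteq> 0" "z Vu \<noteq> 0 \<or> z Vv \<noteq> 0" for z
      using nz[OF that] by (auto simp: Fxy eval_add eval_mult)
    have "\<beta>1 = 0 \<and> \<beta>2 = 0 \<and> - \<beta>3 = 0"
      by (rule low_degree_relation_zero[OF x y q nz' b(1,2) bihom_uminus[OF b(3)] _ eq])
        (use \<open>0 < a\<close> in auto)
    then have z: "\<beta>1 = 0" "\<beta>2 = 0" "\<beta>3 = 0" by simp_all
    with rel g(2) have "\<alpha> = 0" by (auto simp: vec_eq_iff)
    with z show ?thesis by simp
  qed
  show ?thesis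
    by (rule exI[of _ w1], rule exI[of _ w2], rule exI[of _ w3], rule exI[of _ "- y"],
        rule exI[of _ "- x"])
      (use w1 w2 w3 x y indep in \<open>auto simp: bihom_uminus dotF\<close>)
qed

section \<open>Change of generators\<close>

lemma independent_familyD:
  fixes q :: "'i::finite \<Rightarrow> 'k::field R"
  assumes "inj q" "KR.independent (range q)" "(\<Sum>i\<in>UNIV. kscale (c i) (q i)) = 0"
  shows "c i = 0"
proof -
  have "(\<Sum>v\<in>range q. kscale (c (inv q v)) v) = 0"
    using assms(1,3) by (simp add: sum.reindex)
  then have "c (inv q (q i)) = 0"
    using KR.independentD[OF assms(2), of "range q" "\<lambda>v. c (inv q v)" "q i"] by auto
  then show ?thesis using assms(1) by simp
qed

lemma span_range_iff:
  fixes q :: "'i::finite \<Rightarrow> 'k::field R"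
  assumes "inj q"
  shows "v \<in> KR.span (range q) \<longleftrightarrow> (\<exists>c. v = (\<Sum>i\<in>UNIV. kscale (c i) (q i)))"
proof
  assume "v \<in> KR.span (range q)"
  then obtain u where "v = (\<Sum>w\<in>range q. kscale (u w) w)"
    by (auto simp: KR.span_finite)
  then have "v = (\<Sum>i\<in>UNIV. kscale (u (q i)) (q i))" using assms by (simp add: sum.reindex)
  then show "\<exists>c. v = (\<Sum>i\<in>UNIV. kscale (c i) (q i))" by (intro exI)
qed (auto intro: KR.span_sum KR.span_scale KR.span_base)

text \<open>The exchange argument: three vectors cannot span the space of the \<open>p\<^sub>i\<close>, so one \<open>p\<^sub>i\<close> lies outside
  their span, and adding it gives a basis for reasons of dimension.\<close>

lemma complete_to_basis:
  fixes f :: "3 \<Rightarrow> 'k::field R" and p :: "4 \<Rightarrow> 'k R"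
  assumes f: "inj f" "KR.independent (range f)" and p: "inj p" "KR.independent (range p)"
    and sub: "range f \<subseteq> KR.span (range p)"
  shows "\<exists>i0. (\<forall>c e. (\<Sum>k\<in>UNIV. kscale (c k) (f k)) + kscale e (p i0) = 0 \<longrightarrow> (\<forall>k. c k = 0) \<and> e = 0) \<and>
    (\<forall>i. \<exists>c e. p i = (\<Sum>k\<in>UNIV. kscale (c k) (f k)) + kscale e (p i0))"
proof -
  have cards: "card (range f) = 3" "card (range p) = 4"
    using f(1) p(1) by (simp_all add: card_image)
  have "\<not> range p \<subseteq> KR.span (range f)"
    using KR.independent_span_bound[of "range f" "range p"] p(2) cards by auto
  then obtain i0 where i0: "p i0 \<notin> KR.span (range f)" by auto
  let ?D = "insert (p i0) (range f)"
  have ind: "KR.independent ?D" using i0 f(2) by (simp add: KR.independent_insertI)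
  have "p i0 \<notin> range f" using i0 KR.span_base[of "p i0" "range f"] by blast
  then have cardD: "card ?D = 4" using cards by simp
  have "p i \<in> KR.span ?D" for i
  proof (rule ccontr)
    assume n: "p i \<notin> KR.span ?D"
    then have "KR.independent (insert (p i) ?D)" using ind by (rule KR.independent_insertI)
    moreover have "insert (p i) ?D \<subseteq> KR.span (range p)"
      using sub by (auto intro: KR.span_base)
    ultimately have "card (insert (p i) ?D) \<le> 4"
      using KR.independent_span_bound[of "range p" "insert (p i) ?D"] cards by simp
    moreover have "p i \<notin> ?D" using n by (rule contrapos_nn) (rule KR.span_base)
    ultimately show False using cardD by simp
  qed
  then have "\<exists>c e. p i = (\<Sum>k\<in>UNIV. kscale (c k) (f k)) + kscale e (p i0)" for i
    unfolding KR.span_insert span_range_iff[OF f(1)] by (auto simp: algebra_simps) (metis diff_eq_eq)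
  moreover have "(\<forall>k. c k = 0) \<and> e = 0" if z: "(\<Sum>k\<in>UNIV. kscale (c k) (f k)) + kscale e (p i0) = 0" for c e
  proof -
    have e: "e = 0"
    proof (rule ccontr)
      assume "e \<noteq> 0"
      have "kscale e (p i0) = (\<Sum>k\<in>UNIV. kscale (- c k) (f k))"
        using z by (simp add: sum_negf eq_neg_iff_add_eq_0 add.commute)
      then have "kscale e (p i0) \<in> KR.span (range f)" unfolding span_range_iff[OF f(1)] by (intro exI)
      then have "kscale (inverse e) (kscale e (p i0)) \<in> KR.span (range f)" by (rule KR.span_scale)
      then show False using i0 \<open>e \<noteq> 0\<close> by simp
    qed
    then show ?thesis using z independent_familyD[OF f, of c] by simp
  qed
  ultimately show ?thesis by blast
qed

text \<open>\<open>C k i\<close> is the coefficient of \<open>p\<^sub>i\<close> in the \<open>k\<close>-th new generator, so this is the coordinate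
  change from the generators \<open>f\<^sub>0', f\<^sub>1', f\<^sub>2', p\<^sub>i\<^sub>0\<close> back to \<open>p\<close>.\<close>

definition old_coords :: "(3 \<Rightarrow> 4 \<Rightarrow> 'k::field) \<Rightarrow> 4 \<Rightarrow> 'k R ^ 3 \<Rightarrow> 'k R \<Rightarrow> 'k R ^ 4" where
  "old_coords C i0 w h = (\<chi> i. (\<Sum>k\<in>UNIV. const (C k i) * w $ k) + (if i = i0 then h else 0))"

lemma dot_old_coords:
  "dot (old_coords C i0 w h) p = dot w (\<chi> k. \<Sum>i\<in>UNIV. kscale (C k i) (p $ i)) + h * p $ i0"
proof -
  have "old_coords C i0 w h $ i * p $ i
    = (\<Sum>k\<in>UNIV. w $ k * (const (C k i) * p $ i)) + (if i = i0 then h * p $ i else 0)" for i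
    by (simp add: old_coords_def distrib_right sum_distrib_right mult.assoc mult.left_commute)
  then have "dot (old_coords C i0 w h) p
    = (\<Sum>i\<in>UNIV. \<Sum>k\<in>UNIV. w $ k * (const (C k i) * p $ i)) + (\<Sum>i\<in>UNIV. if i = i0 then h * p $ i else 0)"
    by (simp add: dot_def sum.distrib)
  also have "(\<Sum>i\<in>UNIV. \<Sum>k\<in>UNIV. w $ k * (const (C k i) * p $ i))
    = dot w (\<chi> k. \<Sum>i\<in>UNIV. kscale (C k i) (p $ i))"
    unfolding dot_def by (subst sum.swap) (simp add: sum_distrib_left kscale_def)
  finally show ?thesis by simp
qed

lemma old_coords_add: "old_coords C i0 (w + w') (h + h') = old_coords C i0 w h + old_coords C i0 w' h'"
  by (simp add: old_coords_def vec_eq_iff distrib_left sum.distrib)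

lemma old_coords_smult: "old_coords C i0 (c *s w) (c * h) = c *s old_coords C i0 w h"
  by (simp add: old_coords_def vec_eq_iff distrib_left sum_distrib_left mult.left_commute)

lemma old_coords_in_bihom4:
  "(\<And>k. w $ k \<in> bihom c d) \<Longrightarrow> h \<in> bihom c d \<Longrightarrow> old_coords C i0 w h \<in> bihom4 c d"
  unfolding bihom4_def old_coords_def
  by (auto intro!: bihom_add bihom_sum bihom_const_mult)

lemma old_coords_eq_0:
  fixes p :: "'k::field R ^ 4"
  assumes indep: "\<And>c e. (\<Sum>k\<in>UNIV. kscale (c k) (\<Sum>i\<in>UNIV. kscale (C k i) (p $ i))) + kscale e (p $ i0) = 0
      \<Longrightarrow> (\<forall>k. c k = 0) \<and> e = 0"
    and z: "old_coords C i0 w h = 0"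
  shows "w = 0 \<and> h = 0"
proof -
  \<comment> \<open>The new generators are independent over the field, so the vanishing can be tested on the
    coefficients of each monomial.\<close>
  have coeffs: "(\<forall>k. lookup (w $ k) m = 0) \<and> lookup h m = 0" for m
  proof (rule indep)
    have cm: "lookup (const a * x) m = a * lookup x m" for a and x :: "'k R"
    proof -
      have "keys x \<subseteq> UNIV" by simp
      then show ?thesis
        by (induction x rule: poly_mapping_induct_within)
          (auto simp: const_def distrib_left lookup_add mult_single lookup_single when_def)
    qed
    have zi: "(\<Sum>k\<in>UNIV. C k i * lookup (w $ k) m) + (if i = i0 then lookup h m else 0) = 0" for i
    proof -
      have "old_coords C i0 w h $ i = 0" using z by simp
      from arg_cong[OF this, of "\<lambda>x. lookup x m"] show ?thesis
        by (simp add: old_coords_def lookup_add lookup_sum cm split: if_splits)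
    qed
    have "(\<Sum>k\<in>UNIV. kscale (lookup (w $ k) m) (\<Sum>i\<in>UNIV. kscale (C k i) (p $ i))) + kscale (lookup h m) (p $ i0)
      = (\<Sum>k\<in>UNIV. \<Sum>i\<in>UNIV. kscale (C k i * lookup (w $ k) m) (p $ i))
        + (\<Sum>i\<in>UNIV. if i = i0 then kscale (lookup h m) (p $ i) else 0)"
      by (simp add: KR.scale_sum_right mult.commute)
    also have "\<dots> = (\<Sum>i\<in>UNIV. kscale ((\<Sum>k\<in>UNIV. C k i * lookup (w $ k) m)
        + (if i = i0 then lookup h m else 0)) (p $ i))"
      unfolding sum.swap[of _ "UNIV :: 4 set"] KR.scale_left_distrib KR.scale_sum_left sum.distrib
      by (intro arg_cong2[where f = "(+)"] sum.cong refl) auto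
    also have "\<dots> = 0" by (simp add: zi)
    finally show "(\<Sum>k\<in>UNIV. kscale (lookup (w $ k) m) (\<Sum>i\<in>UNIV. kscale (C k i) (p $ i)))
      + kscale (lookup h m) (p $ i0) = 0" .
  qed
  then show ?thesis by (auto simp: vec_eq_iff intro!: poly_mapping_eqI)
qed

section \<open>Counting dimensions\<close>

lemma bihom4_iff: "T \<in> bihom4 c d \<longleftrightarrow> (\<forall>i. T $ i \<in> bihom c d)"
  by (simp add: bihom4_def)

lemma span_range_explicit:
  fixes T :: "'m::finite \<Rightarrow> 'k::field R ^ 4"
  shows "v \<in> RR4.span (range T) \<longleftrightarrow> (\<exists>\<beta>. v = (\<Sum>i\<in>UNIV. \<beta> i *s T i))"
proof
  let ?W = "{v. \<exists>\<beta>. v = (\<Sum>i\<in>UNIV. \<beta> i *s T i)}"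
  have "RR4.subspace ?W"
    unfolding RR4.subspace_def
  proof (safe, goal_cases)
    case 1
    show ?case by (rule exI[of _ "\<lambda>_. 0"]) simp
  next
    case (2 _ _ \<beta> \<beta>')
    show ?case by (rule exI[of _ "\<lambda>i. \<beta> i + \<beta>' i"]) (simp add: RR4.scale_left_distrib sum.distrib)
  next
    case (3 c _ \<beta>)
    show ?case by (rule exI[of _ "\<lambda>i. c * \<beta> i"]) (simp add: RR4.scale_sum_right)
  qed
  moreover have "T i \<in> ?W" for i
    by (auto intro!: exI[of _ "\<lambda>j. if j = i then 1 else 0"] simp: if_distrib[of "\<lambda>c. c *s _"] cong: if_cong)
  ultimately have "RR4.span (range T) \<subseteq> ?W" by (intro RR4.span_minimal image_subsetI)
  then show "v \<in> RR4.span (range T) \<Longrightarrow> \<exists>\<beta>. v = (\<Sum>i\<in>UNIV. \<beta> i *s T i)" by auto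
  show "\<exists>\<beta>. v = (\<Sum>i\<in>UNIV. \<beta> i *s T i) \<Longrightarrow> v \<in> RR4.span (range T)"
    by (elim exE ssubst) (intro RR4.span_sum RR4.span_scale RR4.span_base rangeI)
qed

text \<open>Under the independence hypothesis the graded piece of the span is isomorphic to the direct sum of
  the spaces of coefficients, which consist of the forms of complementary bidegree.\<close>

lemma dim_graded_piece_of_span:
  fixes T :: "'m::finite \<Rightarrow> 'k::field R ^ 4"
  assumes T: "\<And>i. T i \<in> bihom4 (c i) (d i)"
    and deg: "\<And>i. c' i + c i = e" "\<And>i. d' i + d i = f"
    and indep: "\<And>\<beta>. (\<And>i. \<beta> i \<in> bihom (c' i) (d' i)) \<Longrightarrow> (\<Sum>i\<in>UNIV. \<beta> i *s T i) = 0 \<Longrightarrow> (\<forall>i. \<beta> i = 0)"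
  shows "KR4.dim (RR4.span (range T) \<inter> bihom4 e f) = (\<Sum>i\<in>UNIV. Suc (c' i) * Suc (d' i))"
proof -
  define L :: "'k R ^ 'm \<Rightarrow> 'k R ^ 4" where "L = (\<lambda>\<beta>. \<Sum>i\<in>UNIV. \<beta> $ i *s T i)"
  define N where "N = (\<lambda>i. mons (c' i) (d' i))"
  have memN: "\<beta> \<in> supported_in N \<longleftrightarrow> (\<forall>i. \<beta> $ i \<in> bihom (c' i) (d' i))" for \<beta> :: "'k R ^ 'm"
    by (simp add: supported_in_def N_def bihom_iff)
  have L: "L (\<beta> + \<beta>') = L \<beta> + L \<beta>'" "L (const k *s \<beta>) = const k *s L \<beta>" for \<beta> \<beta>' k
    by (simp_all add: L_def RR4.scale_left_distrib sum.distrib RR4.scale_sum_right)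
  have ker: "\<beta> = 0" if "\<beta> \<in> supported_in N" "L \<beta> = 0" for \<beta>
  proof -
    have "\<forall>i. \<beta> $ i = 0" by (rule indep) (use that in \<open>simp_all add: memN L_def\<close>)
    then show ?thesis by (simp add: vec_eq_iff)
  qed
  have image: "L ` supported_in N = RR4.span (range T) \<inter> bihom4 e f"
  proof (intro equalityI subsetI)
    fix v assume "v \<in> L ` supported_in N"
    then obtain \<beta> where v: "v = L \<beta>" and b: "\<And>i. \<beta> $ i \<in> bihom (c' i) (d' i)" by (auto simp: memN)
    have "v \<in> RR4.span (range T)" unfolding span_range_explicit v L_def by (rule exI[of _ "($) \<beta>"]) simp
    moreover have "v $ j \<in> bihom e f" for j
    proof -
      have "\<beta> $ i * T i $ j \<in> bihom e f" for i
        using bihom_mult[OF b, of "T i $ j" "c i" "d i" i] T[of i] by (simp add: deg bihom4_iff)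
      then show ?thesis by (simp add: v L_def sum_component bihom_sum)
    qed
    ultimately show "v \<in> RR4.span (range T) \<inter> bihom4 e f" by (simp add: bihom4_iff)
  next
    fix v assume v: "v \<in> RR4.span (range T) \<inter> bihom4 e f"
    then obtain \<beta> where b: "v = (\<Sum>i\<in>UNIV. \<beta> i *s T i)" by (auto simp: span_range_explicit)
    \<comment> \<open>Only the components of \<open>\<beta>\<close> of complementary bidegree contribute to \<open>v\<close>.\<close>
    have "v $ j = (\<Sum>i\<in>UNIV. bicomp (c' i) (d' i) (\<beta> i) * T i $ j)" for j
    proof -
      have "bicomp e f (\<beta> i * T i $ j) = bicomp (c' i) (d' i) (\<beta> i) * T i $ j" for i
        using bicomp_mult_bihom[of "T i $ j" "c i" "d i" "c' i" "d' i" "\<beta> i"] T[of i]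
        by (simp add: deg bihom4_iff)
      moreover have "v $ j = bicomp e f (v $ j)"
        using v bicomp_bihom[of "v $ j" e f] by (simp add: bihom4_iff)
      ultimately show ?thesis by (simp add: b sum_component bicomp_sum)
    qed
    then have "v = L (\<chi> i. bicomp (c' i) (d' i) (\<beta> i))"
      by (simp add: L_def vec_eq_iff sum_component)
    moreover have "(\<chi> i. bicomp (c' i) (d' i) (\<beta> i)) \<in> supported_in N"
      by (simp add: memN bicomp_in_bihom)
    ultimately show "v \<in> L ` supported_in N" by blast
  qed
  have "VR.dim (L ` supported_in N) = (\<Sum>i\<in>UNIV. card (N i))"
    by (rule dim_injective_image_supported_in[OF linear_injI[OF L ker]]) (simp_all add: N_def)
  then show ?thesis unfolding image kscale4_eq_vscale by (simp only: N_def card_mons)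
qed

lemma bihom_0_expansion:
  fixes f :: "'k::comm_ring_1 R"
  assumes "f \<in> bihom 0 n"
  shows "f = (\<Sum>j = 0..n. single (uv_mon (n - j) j) (lookup f (uv_mon (n - j) j)))"
proof -
  have "bij_betw (\<lambda>j. uv_mon (n - j) j) {0..n} (mons 0 n)"
    by (rule bij_betw_byWitness[where f' = "\<lambda>m. lookup m Vv"])
      (auto simp: uv_mon_def mons_def lookup_add lookup_single intro!: mon_eqI)
  then have "(\<Sum>j = 0..n. single (uv_mon (n - j) j) (lookup f (uv_mon (n - j) j)))
    = (\<Sum>m\<in>mons 0 n. single m (lookup f m))"
    by (rule sum.reindex_bij_betw)
  also have "\<dots> = (\<Sum>m\<in>keys f. single m (lookup f m))"
    using assms by (intro sum.mono_neutral_right) (auto simp: bihom_iff in_keys_iff)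
  finally show ?thesis by (simp flip: poly_mapping_sum_singles)
qed

section \<open>Syzygies of a basepoint free subspace\<close>

definition four_family :: "'x \<Rightarrow> 'x \<Rightarrow> 'x \<Rightarrow> 'x \<Rightarrow> 4 \<Rightarrow> 'x" where
  "four_family x1 x2 x3 x4 i = (if i = 1 then x1 else if i = 2 then x2 else if i = 3 then x3 else x4)"

lemma four_family_simps [simp]:
  "four_family x1 x2 x3 x4 1 = x1" "four_family x1 x2 x3 x4 2 = x2" "four_family x1 x2 x3 x4 3 = x3" "four_family x1 x2 x3 x4 4 = x4"
  by (simp_all add: four_family_def)

lemma range_four_family: "range (four_family x1 x2 x3 x4) = {x1, x2, x3, x4}"
  by (simp add: UNIV_4)

theorem theorem5p11:
  fixes U :: "'k::alg_closed_field R set"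
    and p S :: "'k R ^ 4"
    and a b n \<mu> :: nat
  assumes "1 \<le> a" and "1 \<le> b"
    and "KR.subspace U" and "U \<subseteq> bihom a b" and "KR.dim U = 4"
    and "is_basis_of (\<lambda>i. p $ i) U"
    and "basepoint_free p"
    and "S \<noteq> 0" and "S \<in> syzygies p" and "S \<in> bihom4 0 n"
    and "int b \<ge> 2 * int n - 1"
    and "\<And>m T. m < n \<Longrightarrow> T \<in> syzygies p \<Longrightarrow> T \<in> bihom4 0 m \<Longrightarrow> T = 0"
    and "KR.dim (assoc_V p S n) = 3"
    and "is_mu p S n \<mu>"
  shows "\<exists>S1 S2 S3.
           S1 \<in> syzygies p \<and> S1 \<in> bihom4 a (b - n) \<and>
           S2 \<in> syzygies p \<and> S2 \<in> bihom4 a (b - n + \<mu>) \<and>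
           S3 \<in> syzygies p \<and> S3 \<in> bihom4 a (b - \<mu>) \<and>
           KR4.dim (RR4.span {S, S1, S2, S3} \<inter> bihom4 (2 * a - 1) (b - 1)) = 2 * a * b"
proof -
  obtain J B where basis: "is_basis_of (\<lambda>k. assoc_f p S n (J k)) (assoc_V p S n)"
    and J: "\<And>k. J k \<le> n"
    and B: "\<And>j. j \<le> n \<Longrightarrow> (\<Sum>k\<in>UNIV. kscale (B k j) (assoc_f p S n (J k))) = assoc_f p S n j"
    and res: "has_resolution
          (\<chi> k. \<Sum>j = 0..n. single (uv_mon (n - j) j) (B k j)) n \<mu>"
    using \<open>is_mu p S n \<mu>\<close> unfolding is_mu_def by blast
  define g :: "'k R ^ 3" where "g = (\<chi> k. \<Sum>j = 0..n. single (uv_mon (n - j) j) (B k j))"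
  define \<nu> where "\<nu> = n - \<mu>"
  note res' = res[unfolded has_resolution_def, folded g_def \<nu>_def dot_def]
  obtain P Q where "\<forall>k. P $ k \<in> bihom 0 \<mu>" "\<forall>k. Q $ k \<in> bihom 0 \<nu>"
    and syz: "{w. (\<forall>k. w $ k \<in> A_ring) \<and> dot w g = 0} =
          {x *s P + y *s Q | x y. x \<in> A_ring \<and> y \<in> A_ring}"
    using res' by (elim conjE exE) (rule that; assumption)
  then have P: "P $ k \<in> bihom 0 \<mu>" and Q: "Q $ k \<in> bihom 0 \<nu>" for k by simp_all
  have g: "g $ k \<in> bihom 0 n" and mu: "1 \<le> \<mu>" "\<mu> \<le> \<nu>" for k
    using res' by simp_all
  have exact: "\<exists>x\<in>A_ring. \<exists>y\<in>A_ring. w = x *s P + y *s Q"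
    if "\<And>k. w $ k \<in> A_ring" "dot w g = 0" for w
    using syz that by blast
  have zero_A: "(0 :: 'k R) \<in> A_ring" by (simp add: A_ring_def)
  have "1 *s P + 0 *s Q \<in> {w. (\<forall>k. w $ k \<in> A_ring) \<and> dot w g = 0}"
    "0 *s P + 1 *s Q \<in> {w. (\<forall>k. w $ k \<in> A_ring) \<and> dot w g = 0}"
    unfolding syz using one_in_A_ring zero_A by blast+
  then have PQ: "dot P g = 0" "dot Q g = 0" by simp_all
  have nums: "n = \<mu> + \<nu>" "0 < n" "2 * n \<le> Suc b" "0 < a"
    using mu \<open>int b \<ge> _\<close> \<open>1 \<le> a\<close> by (auto simp: \<nu>_def)

  have p: "inj (($) p)" "KR.independent (range (($) p))" "KR.span (range (($) p)) = U"
    using \<open>is_basis_of (\<lambda>i. p $ i) U\<close> unfolding is_basis_of_def by auto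
  define C where "C = (\<lambda>k i. lookup (S $ i) (uv_mon (n - J k) (J k)))"
  define f where "f = (\<lambda>k. \<Sum>i\<in>UNIV. kscale (C k i) (p $ i))"
  have f_eq: "assoc_f p S n (J k) = f k" for k
    by (simp add: f_def C_def assoc_f_def)
  have f: "inj f" "KR.independent (range f)"
    using basis unfolding is_basis_of_def f_eq by auto
  have f_span: "f k \<in> U" for k
    unfolding f_def p(3)[symmetric] by (intro KR.span_sum KR.span_scale KR.span_base rangeI)

  \<comment> \<open>Compare coordinates with respect to the basis \<open>p\<close> in the expansion of each \<open>f\<^sub>j\<close> in the basis of \<open>V\<close>.\<close>
  have coeff_S: "lookup (S $ i) (uv_mon (n - j) j) = (\<Sum>k\<in>UNIV. C k i * B k j)" if "j \<le> n" for i j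
  proof -
    define c where "c = (\<lambda>i. (\<Sum>k\<in>UNIV. C k i * B k j) - lookup (S $ i) (uv_mon (n - j) j))"
    have "(\<Sum>i\<in>UNIV. kscale (\<Sum>k\<in>UNIV. C k i * B k j) (p $ i))
        = (\<Sum>k\<in>UNIV. kscale (B k j) (f k))"
      unfolding f_def KR.scale_sum_left KR.scale_sum_right
      by (subst sum.swap) (simp add: mult.commute)
    also have "\<dots> = assoc_f p S n j" using B[OF that] by (simp add: f_eq)
    finally have "(\<Sum>i\<in>UNIV. kscale (c i) (p $ i)) = 0"
      by (simp add: c_def KR.scale_left_diff_distrib sum_subtractf assoc_f_def)
    then have "c i = 0" by (rule independent_familyD[OF p(1,2)])
    then show ?thesis by (simp add: c_def)
  qed
  obtain i0 where
    indep: "\<And>c e. (\<Sum>k\<in>UNIV. kscale (c k) (f k)) + kscale e (p $ i0) = 0 \<Longrightarrow> (\<forall>k. c k = 0) \<and> e = 0"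
    and gen: "\<And>i. \<exists>c e. p $ i = (\<Sum>k\<in>UNIV. kscale (c k) (f k)) + kscale e (p $ i0)"
    using complete_to_basis[OF f p(1,2)] f_span p(3) by blast
  define F :: "'k R ^ 3" where "F = (\<chi> k. f k)"
  define \<Phi> where "\<Phi> = old_coords C i0"
  have dot_\<Phi>: "dot (\<Phi> w h) p = dot w F + h * p $ i0" for w h
    by (simp add: \<Phi>_def dot_old_coords F_def f_def)
  have \<Phi>_eq_0: "w = 0 \<and> h = 0" if "\<Phi> w h = 0" for w h
    using old_coords_eq_0[of C p i0 w h] indep that unfolding \<Phi>_def f_def by blast
  have \<Phi>_in: "\<Phi> w h \<in> bihom4 c d" if "\<forall>k. w $ k \<in> bihom c d" "h \<in> bihom c d" for w h c d
    using that unfolding \<Phi>_def by (intro old_coords_in_bihom4) auto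
  have syzygies: "T \<in> syzygies p \<longleftrightarrow> dot T p = 0" for T
    by (simp add: syzygies_def dot_def)
  have S: "S = \<Phi> g 0"
  proof -
    have "S $ i = \<Phi> g 0 $ i" for i
    proof -
      have "S $ i = (\<Sum>j = 0..n. single (uv_mon (n - j) j) (\<Sum>k\<in>UNIV. C k i * B k j))"
        using bihom_0_expansion[of "S $ i" n] \<open>S \<in> bihom4 0 n\<close> by (simp add: coeff_S bihom4_iff)
      also have "\<dots> = (\<Sum>k\<in>UNIV. const (C k i) * g $ k)"
        unfolding g_def const_def
        by (simp add: sum_3 sum_distrib_left mult_single single_add sum.distrib)
      finally show ?thesis by (simp add: \<Phi>_def old_coords_def)
    qed
    then show ?thesis by (simp add: vec_eq_iff)
  qed
  have "g \<noteq> 0"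
  proof
    assume "g = 0"
    then have "S = 0" by (simp add: S \<Phi>_def old_coords_def vec_eq_iff)
    then show False using \<open>S \<noteq> 0\<close> by contradiction
  qed
  have "dot F g = 0"
    using \<open>S \<in> syzygies p\<close> by (simp add: syzygies S dot_\<Phi> dot_commute[of F])
  have F_in: "F $ k \<in> bihom a b" for k using f_span \<open>U \<subseteq> bihom a b\<close> by (auto simp: F_def)
  have q_in: "p $ i0 \<in> bihom a b"
    using p(3) KR.span_base[of "p $ i0"] \<open>U \<subseteq> bihom a b\<close> by blast
  have q_ne: "p $ i0 \<noteq> 0" using indep[of "\<lambda>_. 0" 1] by auto
  have minimal: "w = 0" if "\<And>k. w $ k \<in> bihom 0 (n - 1)" "dot w F = 0" for w
  proof -
    have "\<Phi> w 0 = 0"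
      by (rule assms(12)[of "n - 1"]) (use that nums in \<open>simp_all add: syzygies dot_\<Phi> \<Phi>_in\<close>)
    then show ?thesis using \<Phi>_eq_0 by blast
  qed
  have nz: "eval x (p $ i0) \<noteq> 0"
    if "x Vs \<noteq> 0 \<or> x Vt \<noteq> 0" "x Vu \<noteq> 0 \<or> x Vv \<noteq> 0" "\<And>k. eval x (F $ k) = 0" for x
  proof
    assume z: "eval x (p $ i0) = 0"
    have "eval x (p $ i) = 0" for i
    proof -
      obtain c e where "p $ i = (\<Sum>k\<in>UNIV. kscale (c k) (f k)) + kscale e (p $ i0)" using gen by blast
      then show ?thesis using z that(3) by (simp add: F_def eval_add eval_sum eval_mult kscale_def)
    qed
    then show False using \<open>basepoint_free p\<close> that(1,2) unfolding basepoint_free_def by blast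
  qed
  obtain w1 w2 w3 h2 h3 where
    w1: "\<forall>k. w1 $ k \<in> bihom a (b - n)" "dot w1 F = 0" and
    w2: "\<forall>k. w2 $ k \<in> bihom a (b - \<nu>)" "h2 \<in> bihom a (b - \<nu>)" "dot w2 F + h2 * p $ i0 = 0" and
    w3: "\<forall>k. w3 $ k \<in> bihom a (b - \<mu>)" "h3 \<in> bihom a (b - \<mu>)" "dot w3 F + h3 * p $ i0 = 0" and
    free: "\<And>\<alpha> \<beta>1 \<beta>2 \<beta>3. \<beta>1 \<in> bihom (a - 1) (n - 1) \<Longrightarrow> \<beta>2 \<in> bihom (a - 1) (\<nu> - 1) \<Longrightarrow>
      \<beta>3 \<in> bihom (a - 1) (\<mu> - 1) \<Longrightarrow> \<alpha> *s g + \<beta>1 *s w1 + \<beta>2 *s w2 + \<beta>3 *s w3 = 0 \<Longrightarrow>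
      \<beta>2 * h2 + \<beta>3 * h3 = 0 \<Longrightarrow> \<alpha> = 0 \<and> \<beta>1 = 0 \<and> \<beta>2 = 0 \<and> \<beta>3 = 0"
    using adapted_syzygies[where F = F and g = g and P = P and Q = Q and q = "p $ i0"
        and n = n and \<mu> = \<mu> and \<nu> = \<nu> and a = a and b = b,
        OF exact PQ g \<open>g \<noteq> 0\<close> P Q nums F_in \<open>dot F g = 0\<close> q_in q_ne minimal nz]
    by blast
  define S1 S2 S3 where "S1 = \<Phi> w1 0" and "S2 = \<Phi> w2 h2" and "S3 = \<Phi> w3 h3"
  have syz123: "S1 \<in> syzygies p" "S2 \<in> syzygies p" "S3 \<in> syzygies p"
    using w1 w2 w3 by (simp_all add: syzygies dot_\<Phi> S1_def S2_def S3_def)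
  have deg123: "S1 \<in> bihom4 a (b - n)" "S2 \<in> bihom4 a (b - \<nu>)" "S3 \<in> bihom4 a (b - \<mu>)"
    using w1 w2 w3 by (simp_all add: \<Phi>_in S1_def S2_def S3_def)
  have b_eq: "b - \<nu> = b - n + \<mu>" using nums by auto

  define c' d' where "c' = four_family (2 * a - 1) (a - 1) (a - 1) (a - 1)"
    and "d' = four_family (b - 1 - n) (n - 1) (\<nu> - 1) (\<mu> - 1)"
  have "KR4.dim (RR4.span (range (four_family S S1 S2 S3)) \<inter> bihom4 (2 * a - 1) (b - 1))
      = (\<Sum>i\<in>UNIV. Suc (c' i) * Suc (d' i))"
  proof (rule dim_graded_piece_of_span)
    have "\<forall>i. four_family S S1 S2 S3 i \<in> bihom4 (four_family 0 a a a i) (four_family n (b - n) (b - \<nu>) (b - \<mu>) i)"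
      unfolding forall_4 using deg123 \<open>S \<in> bihom4 0 n\<close> by simp
    then show "four_family S S1 S2 S3 i \<in> bihom4 (four_family 0 a a a i) (four_family n (b - n) (b - \<nu>) (b - \<mu>) i)" for i ..
    have "\<forall>i. c' i + four_family 0 a a a i = 2 * a - 1"
      unfolding forall_4 using nums by (auto simp: c'_def)
    then show "c' i + four_family 0 a a a i = 2 * a - 1" for i ..
    have "\<forall>i. d' i + four_family n (b - n) (b - \<nu>) (b - \<mu>) i = b - 1"
      unfolding forall_4 using nums mu by (auto simp: d'_def)
    then show "d' i + four_family n (b - n) (b - \<nu>) (b - \<mu>) i = b - 1" for i ..
    fix \<beta> assume b: "\<And>i. \<beta> i \<in> bihom (c' i) (d' i)"
      and z: "(\<Sum>i\<in>UNIV. \<beta> i *s four_family S S1 S2 S3 i) = 0"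
    have "(\<Sum>i\<in>UNIV. \<beta> i *s four_family S S1 S2 S3 i)
        = \<Phi> (\<beta> 1 *s g + \<beta> 2 *s w1 + \<beta> 3 *s w2 + \<beta> 4 *s w3) (\<beta> 3 * h2 + \<beta> 4 * h3)"
      using old_coords_add[of C i0 _ _ 0 0]
      by (simp add: sum_4 S S1_def S2_def S3_def \<Phi>_def flip: old_coords_smult old_coords_add)
    with z have "\<beta> 1 *s g + \<beta> 2 *s w1 + \<beta> 3 *s w2 + \<beta> 4 *s w3 = 0 \<and> \<beta> 3 * h2 + \<beta> 4 * h3 = 0"
      by (intro \<Phi>_eq_0) simp
    then have "\<beta> 1 = 0 \<and> \<beta> 2 = 0 \<and> \<beta> 3 = 0 \<and> \<beta> 4 = 0"
      using free[of "\<beta> 2" "\<beta> 3" "\<beta> 4" "\<beta> 1"] b[of 2] b[of 3] b[of 4] by (simp add: c'_def d'_def)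
    then show "\<forall>i. \<beta> i = 0" unfolding forall_4 .
  qed
  also have "\<dots> = 2 * a * (b - n) + a * n + a * \<nu> + a * \<mu>"
  proof -
    have "Suc (2 * a - 1) = 2 * a" "Suc (a - 1) = a" "Suc (b - 1 - n) = b - n" "Suc (n - 1) = n"
      "Suc (\<nu> - 1) = \<nu>" "Suc (\<mu> - 1) = \<mu>" using nums mu by auto
    then show ?thesis unfolding sum_4 c'_def d'_def four_family_simps by (simp only:)
  qed
  also have "\<dots> = 2 * a * ((b - n) + n)" by (simp add: nums(1) algebra_simps)
  also have "(b - n) + n = b" using nums by auto
  finally show ?thesis using syz123 deg123 unfolding range_four_family b_eq by blast
qed

end
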